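(* For every integer $n \ge 1$, $\mu_o(ST_3^n) = 3$ if $n = 1$, and $\mu_o(ST_3^n) = 3^{n-2} + 3$ if $n \ge 2$.
   Context: Sierpiński triangle graphs are defined recursively: $ST_3^0 = K_3$, whose three vertices are its extreme vertices, called top, left and right. For $n \ge 0$, $ST_3^{n+1}$ is obtained from three disjoint copies $T, L, R$ of $ST_3^n$ by identifying the left extreme vertex of $T$ with the top extreme vertex of $L$, the right extreme vertex of $T$ with the top extreme vertex of $R$, and the right extreme vertex of $L$ with the left extreme vertex of $R$; the extreme vertices of $ST_3^{n+1}$ are the top vertex of $T$, the left vertex of $L$ and the right vertex of $R$. For a graph $G$ and $M \subseteq V(G)$, vertices $u,v$ are $M$-visible if some shortest $u,v$-path in $G$ contains no vertex of $M \setminus \{u,v\}$. $M$ is an outer mutual-visibility set of $G$ if every two vertices of $M$ are $M$-visible and every $u \in M$, $v \in V(G)\setminus M$ are $M$-visible. $\mu_o(G)$ is the largest cardinality of an outer mutual-visibility set of $G$. *)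

theory Defs
  imports "Graph_Theory.Graph_Theory"
begin

definition shortest_vpath ::
    "'a pair_pre_digraph \<Rightarrow> 'a \<Rightarrow> 'a vwalk \<Rightarrow> 'a \<Rightarrow> bool" where
  "shortest_vpath G u p v \<longleftrightarrow>
     vpath p G \<and> hd p = u \<and> last p = v \<and>
     (\<forall>q. vpath q G \<and> hd q = u \<and> last q = v \<longrightarrow> vwalk_length p \<le> vwalk_length q)"

definition visible :: "'a pair_pre_digraph \<Rightarrow> 'a set \<Rightarrow> 'a \<Rightarrow> 'a \<Rightarrow> bool" where
  "visible G M u v \<longleftrightarrow> (\<exists>p. shortest_vpath G u p v \<and> set p \<inter> (M - {u, v}) = {})"

definition outer_mutual_visibility_set :: "'a pair_pre_digraph \<Rightarrow> 'a set \<Rightarrow> bool" where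
  "outer_mutual_visibility_set G M \<longleftrightarrow>
     M \<subseteq> pverts G \<and>
     (\<forall>u\<in>M. \<forall>v\<in>M. u \<noteq> v \<longrightarrow> visible G M u v) \<and>
     (\<forall>u\<in>M. \<forall>v\<in>pverts G - M. visible G M u v)"

text \<open>Only meaningful for finite graphs, since \<^const>\<open>Max\<close> is.\<close>

definition outer_mutual_visibility_number :: "'a pair_pre_digraph \<Rightarrow> nat" (\<open>\<mu>\<^sub>o\<close>) where
  "\<mu>\<^sub>o G = Max (card ` {M. outer_mutual_visibility_set G M})"


text \<open>
  The three corners name both the extreme vertices and the three copies. The vertex \<open>v\<close> of the
  copy named \<open>c\<close> is \<open>c # v\<close> in the disjoint union, and each pair of identified vertices is
  represented by one of its two elements, chosen by \<open>ST_glue\<close>.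
\<close>

datatype corner = Top | Left | Right

primrec ST_extreme :: "nat \<Rightarrow> corner \<Rightarrow> corner list" where
  "ST_extreme 0 c = [c]"
| "ST_extreme (Suc n) c = c # ST_extreme n c"

definition ST_glue :: "nat \<Rightarrow> corner list \<Rightarrow> corner list" where
  "ST_glue n v =
     (if v = Left # ST_extreme n Top then Top # ST_extreme n Left
      else if v = Right # ST_extreme n Top then Top # ST_extreme n Right
      else if v = Right # ST_extreme n Left then Left # ST_extreme n Right
      else v)"

primrec ST\<^sub>3 :: "nat \<Rightarrow> corner list pair_pre_digraph" where
  "ST\<^sub>3 0 =
     (let V = {ST_extreme 0 Top, ST_extreme 0 Left, ST_extreme 0 Right}
      in \<lparr>pverts = V, parcs = {(u, v). u \<in> V \<and> v \<in> V \<and> u \<noteq> v}\<rparr>)"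
| "ST\<^sub>3 (Suc n) =
     \<lparr>pverts = {ST_glue n (c # v) | c v. v \<in> pverts (ST\<^sub>3 n)},
      parcs = {(ST_glue n (c # u), ST_glue n (c # v)) | c u v. (u, v) \<in> parcs (ST\<^sub>3 n)}\<rparr>"

lemma ST_extreme_eq_iff [simp]: "ST_extreme n c = ST_extreme n d \<longleftrightarrow> c = d"
  by (cases n) auto

text \<open>The kernel of \<open>ST_glue n\<close> is exactly the prescribed identification.\<close>

lemma ST_glue_eq_iff:
  "ST_glue n u = ST_glue n v \<longleftrightarrow>
     u = v \<or>
     {u, v} = {Top # ST_extreme n Left, Left # ST_extreme n Top} \<or>
     {u, v} = {Top # ST_extreme n Right, Right # ST_extreme n Top} \<or>
     {u, v} = {Left # ST_extreme n Right, Right # ST_extreme n Left}"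
  by (auto simp: ST_glue_def doubleton_eq_iff)

lemma ST_glue_extreme: "ST_glue n (c # ST_extreme n c) = ST_extreme (Suc n) c"
  by (cases c) (auto simp: ST_glue_def)

lemma ST_extreme_in_verts: "ST_extreme n c \<in> pverts (ST\<^sub>3 n)"
proof (induction n)
  case 0
  then show ?case by (cases c) (auto simp: Let_def)
next
  case (Suc n)
  then show ?case using ST_glue_extreme[of n c, symmetric] by auto
qed

lemma ST_glue_Cons_inj: "ST_glue n (c # u) = ST_glue n (c # v) \<Longrightarrow> u = v"
  by (auto simp: ST_glue_eq_iff doubleton_eq_iff)

lemma pair_graph_ST: "pair_graph (ST\<^sub>3 n)"
proof (induction n)
  case 0
  show ?case
    by unfold_locales
      (auto simp: Let_def symmetric_def intro!: symI
            intro: finite_subset[of _ "{[Top], [Left], [Right]} \<times> {[Top], [Left], [Right]}"])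
next
  case (Suc n)
  then interpret pair_graph "ST\<^sub>3 n" .
  have corners: "finite (UNIV :: corner set)"
    by (rule finite_subset[of _ "{Top, Left, Right}"]) (auto intro: corner.exhaust)
  have V: "pverts (ST\<^sub>3 (Suc n)) = (\<lambda>(c, v). ST_glue n (c # v)) ` (UNIV \<times> pverts (ST\<^sub>3 n))"
    by auto
  have A: "parcs (ST\<^sub>3 (Suc n)) =
      (\<lambda>(c, u, v). (ST_glue n (c # u), ST_glue n (c # v))) ` (UNIV \<times> parcs (ST\<^sub>3 n))"
    by force
  have sym: "(v, u) \<in> parcs (ST\<^sub>3 n)" if "(u, v) \<in> parcs (ST\<^sub>3 n)" for u v
    using that pair_sym_arcs by (auto simp: symmetric_def dest: symD)
  show ?case
  proof unfold_locales
    show "finite (pverts (ST\<^sub>3 (Suc n)))" "finite (parcs (ST\<^sub>3 (Suc n)))"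
      unfolding V A using corners pair_finite_verts pair_finite_arcs by auto
    show "symmetric (with_proj (ST\<^sub>3 (Suc n)))"
      by (auto simp: symmetric_def intro!: symI dest: sym)
    fix e assume "e \<in> parcs (ST\<^sub>3 (Suc n))"
    then show "fst e \<noteq> snd e"
      by (auto dest!: ST_glue_Cons_inj dest: pair_no_loops)
  qed (auto dest: arc_fst_in_verts arc_snd_in_verts, (fastforce dest: arc_fst_in_verts arc_snd_in_verts)+)
qed

end

theory Submission
  imports Defs
begin

text \<open>
  Between two copies of \<open>ST\<^sub>3\<^sup>n\<close> there are only two routes: directly through the common junction, or
  around through the third copy. So distances and the existence of geodesics avoiding a given
  set are determined by the copies, via distances to their extreme vertices.

  For the upper bound \<open>b + 3\<close>, where \<open>b = 3 ^ (n - 2)\<close>, let \<open>M\<close> be an outer mutual-visibility set of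
  \<open>ST\<^sub>3\<^sup>(\<^sup>n\<^sup>+\<^sup>1\<^sup>)\<close>. Junctions in \<open>M\<close> make \<open>M\<close> small. Otherwise each copy meets \<open>M\<close> in such a set, and an
  extreme vertex of the copy from which everything in the copy is visible may be added to it. If
  both junctions of each copy may be added, each copy contains at most \<open>b + 1\<close> points, as
  required. If a junction \<open>c | d\<close> may not be added in the copy \<open>d\<close>, then the points in \<open>c\<close> have to
  use the detour through \<open>e\<close>, hence lie strictly closer to \<open>e\<close> than to \<open>d\<close>; for such one-sided sets
  the bound improves by one, which makes up for the loss. The induction starts with a
  case analysis of \<open>ST\<^sub>3\<^sup>2\<close>.

  For the lower bound, one inner vertex in each copy of \<open>ST\<^sub>3\<^sup>2\<close>, together with the three extreme
  vertices, is an outer mutual-visibility set.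
\<close>

subsection \<open>Geodesics avoiding a set\<close>

text \<open>With explicit lengths, geodesics become walks of minimal length and simplicity of paths
  never has to be handled. The ends must avoid \<open>X\<close> too, so visibility takes
  \<open>X = M - {u, v}\<close>.\<close>

primrec walk :: "'a pair_pre_digraph \<Rightarrow> 'a set \<Rightarrow> 'a \<Rightarrow> 'a \<Rightarrow> nat \<Rightarrow> bool" where
  "walk G X u v 0 \<longleftrightarrow> u = v \<and> u \<in> pverts G - X"
| "walk G X u w (Suc l) \<longleftrightarrow> (\<exists>v. walk G X u v l \<and> (v, w) \<in> parcs G \<and> w \<in> pverts G - X)"

definition gdist :: "'a pair_pre_digraph \<Rightarrow> 'a \<Rightarrow> 'a \<Rightarrow> nat" where
  "gdist G u v = (LEAST l. walk G {} u v l)"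

text \<open>The length is minimal in the whole graph, while \<open>X\<close> only restricts the
  vertices. \<open>geo G {} u v\<close> expresses connectedness, which is what makes
  \<open>gdist G u v\<close> meaningful.\<close>

definition geo :: "'a pair_pre_digraph \<Rightarrow> 'a set \<Rightarrow> 'a \<Rightarrow> 'a \<Rightarrow> bool" where
  "geo G X u v \<longleftrightarrow> walk G X u v (gdist G u v)"

lemma walk_ends: "walk G X u v l \<Longrightarrow> u \<in> pverts G - X \<and> v \<in> pverts G - X"
  by (induction l arbitrary: v) auto

lemma walk_trans: "walk G X v w l \<Longrightarrow> walk G X u v k \<Longrightarrow> walk G X u w (k + l)"
  by (induction l arbitrary: w) auto

lemma walk_antimono: "walk G Y u v l \<Longrightarrow> X \<subseteq> Y \<Longrightarrow> walk G X u v l"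
  by (induction l arbitrary: v) auto

lemma walk_sym:
  assumes "symmetric (with_proj G)" and "walk G X u v l"
  shows "walk G X v u l"
  using assms(2)
proof (induction l arbitrary: v)
  case (Suc l)
  then obtain w where w: "walk G X u w l" "(w, v) \<in> parcs G" "v \<in> pverts G - X" by auto
  then have "(v, w) \<in> parcs G" using assms(1) by (auto simp: symmetric_def dest: symD)
  with w walk_ends[OF w(1)] have "walk G X v w 1" by auto
  from walk_trans[OF Suc.IH[OF w(1)] this] show ?case by simp
qed auto

lemma walk_image:
  assumes "walk G X u v l"
    and "\<And>v. v \<in> pverts G - X \<Longrightarrow> f v \<in> pverts H - Y"
    and "\<And>v w. (v, w) \<in> parcs G \<Longrightarrow> (f v, f w) \<in> parcs H"
  shows "walk H Y (f u) (f v) l"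
  using assms(1) by (induction l arbitrary: v) (use assms(2,3) in \<open>auto, blast\<close>)

lemma gdist_le: "walk G X u v l \<Longrightarrow> gdist G u v \<le> l"
  unfolding gdist_def by (auto intro: Least_le walk_antimono)

lemma gdist_eqI:
  assumes "walk G X u v l" and "\<And>k. walk G {} u v k \<Longrightarrow> l \<le> k"
  shows "gdist G u v = l"
  unfolding gdist_def using assms by (intro Least_equality) (auto intro: walk_antimono)

lemma gdist_self [simp]: "u \<in> pverts G \<Longrightarrow> gdist G u u = 0"
  by (rule gdist_eqI[where X = "{}"]) auto

lemma geo_self [simp]: "geo G X u u \<longleftrightarrow> u \<in> pverts G - X"
  by (auto simp: geo_def dest: walk_ends)

lemma geo_ends: "geo G X u v \<Longrightarrow> u \<in> pverts G - X \<and> v \<in> pverts G - X"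
  unfolding geo_def by (rule walk_ends)

lemma geo_antimono: "geo G Y u v \<Longrightarrow> X \<subseteq> Y \<Longrightarrow> geo G X u v"
  unfolding geo_def by (rule walk_antimono)

lemma geo_if_walk: "walk G X u v l \<Longrightarrow> l \<le> gdist G u v \<Longrightarrow> geo G X u v"
  unfolding geo_def using gdist_le le_antisym by metis

lemma geo_extend:
  assumes "geo G X u v" "(v, w) \<in> parcs G" "w \<in> pverts G - X" "gdist G u w = gdist G u v + 1"
  shows "geo G X u w"
  using assms unfolding geo_def by auto

lemma geo_empty_if_walk: "walk G X u v l \<Longrightarrow> geo G {} u v"
  unfolding geo_def gdist_def by (rule LeastI[where k = l]) (auto intro: walk_antimono)

lemma gdist_sym: "symmetric (with_proj G) \<Longrightarrow> gdist G u v = gdist G v u"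
  unfolding gdist_def by (rule arg_cong[where f = Least]) (auto simp: fun_eq_iff intro: walk_sym)

lemma geo_sym: "symmetric (with_proj G) \<Longrightarrow> geo G X u v \<longleftrightarrow> geo G X v u"
  unfolding geo_def by (metis walk_sym gdist_sym)

lemma gdist_triangle:
  assumes "geo G {} u v" "geo G {} v w"
  shows "gdist G u w \<le> gdist G u v + gdist G v w"
  using assms unfolding geo_def by (metis walk_trans gdist_le)

lemma gdist_step: "geo G {} u v \<Longrightarrow> (v, w) \<in> parcs G \<Longrightarrow> w \<in> pverts G \<Longrightarrow> gdist G u w \<le> gdist G u v + 1"
  unfolding geo_def using gdist_le[of G "{}" u w "Suc (gdist G u v)"] by auto

lemma gdist_eq_0_iff: "geo G {} u v \<Longrightarrow> gdist G u v = 0 \<longleftrightarrow> u = v"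
  unfolding geo_def using walk_ends[of G "{}" u v] by (auto dest: walk_ends)

section \<open>Vertex walks and visibility in terms of walks of given length\<close>

lemma walk_if_vwalk:
  "vwalk p (with_proj G) \<Longrightarrow> set p \<inter> X = {} \<Longrightarrow> walk G X (hd p) (last p) (length p - 1)"
proof (induction p rule: rev_induct)
  case (snoc w p)
  show ?case
  proof (cases "p = []")
    case False
    then have "walk G X (hd p) (last p) (length p - 1)"
      using snoc vwalkI_append_l[of p "[w]"] by auto
    moreover have "(last p, w) \<in> parcs G" "w \<in> pverts G"
      using snoc.prems False by (auto simp: vwalk_def vwalk_arcs_append)
    ultimately have "walk G X (hd p) w (Suc (length p - 1))"
      using snoc.prems by auto
    then show ?thesis using False by (simp add: Suc_diff_1)
  qed (use snoc in \<open>auto simp: vwalk_def\<close>)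
qed (simp add: vwalk_def)

lemma vwalk_if_walk:
  assumes "walk G X u v l"
  shows "\<exists>p. vwalk p (with_proj G) \<and> set p \<inter> X = {} \<and> hd p = u \<and> last p = v \<and> length p = Suc l"
  using assms
proof (induction l arbitrary: v)
  case 0
  then show ?case by (intro exI[of _ "[u]"]) (auto simp: vwalk_def)
next
  case (Suc l)
  then obtain w where w: "walk G X u w l" "(w, v) \<in> parcs G" "v \<in> pverts G - X" by auto
  from Suc.IH[OF w(1)] obtain p where p: "vwalk p (with_proj G)" "set p \<inter> X = {}" "hd p = u"
    "last p = w" "length p = Suc l" by blast
  then have "p \<noteq> []" by auto
  with p w show ?case
    by (intro exI[of _ "p @ [v]"]) (auto simp: vwalk_def vwalk_arcs_append)
qed

lemma length_vwalk_to_vpath: "length (vwalk_to_vpath p) \<le> length p"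
  by (induction p rule: vwalk_to_vpath_induct3)
    (auto intro: order_trans le_SucI length_dropWhile_le)

text \<open>Cutting cycles out of a vertex walk never lengthens it and only drops vertices, so paths
  and walks have the same minimal length and avoid the same sets.\<close>

lemma visible_iff_geo: "visible G M u v \<longleftrightarrow> geo G (M - {u, v}) u v"
proof
  assume "visible G M u v"
  then obtain p where p: "vpath p (with_proj G)" "hd p = u" "last p = v"
    "set p \<inter> (M - {u, v}) = {}"
    and min: "\<And>q. vpath q (with_proj G) \<Longrightarrow> hd q = u \<Longrightarrow> last q = v \<Longrightarrow> length p - 1 \<le> length q - 1"
    by (auto simp: visible_def shortest_vpath_def)
  have w: "walk G (M - {u, v}) u v (length p - 1)"
    using walk_if_vwalk[of p G] p by (auto simp: vpath_def)
  moreover have "length p - 1 \<le> gdist G u v"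
  proof -
    have "walk G {} u v (gdist G u v)"
      using geo_empty_if_walk[OF w] by (simp add: geo_def)
    then obtain q where q: "vwalk q (with_proj G)" "hd q = u" "last q = v"
      "length q = Suc (gdist G u v)" using vwalk_if_walk by metis
    have "length p - 1 \<le> length (vwalk_to_vpath q) - 1"
      using q by (intro min) (auto simp: vwalk_to_vpath_vpath vwalk_to_vpath_hd vwalk_to_vpath_last)
    then show ?thesis using length_vwalk_to_vpath[of q] q(4) by linarith
  qed
  ultimately show "geo G (M - {u, v}) u v" by (rule geo_if_walk)
next
  assume g: "geo G (M - {u, v}) u v"
  then obtain p where p: "vwalk p (with_proj G)" "set p \<inter> (M - {u, v}) = {}" "hd p = u" "last p = v"
    "length p = Suc (gdist G u v)" unfolding geo_def using vwalk_if_walk by metis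
  let ?p = "vwalk_to_vpath p"
  have "vwalk_length ?p \<le> vwalk_length q" if "vpath q (with_proj G)" "hd q = u" "last q = v" for q
  proof -
    have "walk G {} u v (length q - 1)"
      using walk_if_vwalk[of q G "{}"] that by (auto simp: vpath_def)
    from gdist_le[OF this] show ?thesis using length_vwalk_to_vpath[of p] p(5) by simp
  qed
  with p have "shortest_vpath G u ?p v"
    unfolding shortest_vpath_def
    by (auto simp: vwalk_to_vpath_vpath vwalk_to_vpath_hd vwalk_to_vpath_last simp del: vwalk_length_simp)
  moreover have "set ?p \<inter> (M - {u, v}) = {}"
    using p(2) vwalk_to_vpath_subset[of _ p] by blast
  ultimately show "visible G M u v" unfolding visible_def by blast
qed

lemma outer_mutual_visibility_set_iff:
  "outer_mutual_visibility_set G M \<longleftrightarrow>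
     M \<subseteq> pverts G \<and> (\<forall>u\<in>M. \<forall>v\<in>pverts G. geo G (M - {u, v}) u v)"
  unfolding outer_mutual_visibility_set_def visible_iff_geo
  by (auto simp: subset_iff) (metis DiffI insert_iff geo_self Diff_iff)

subsection \<open>Geodesics across the copies\<close>

definition emb :: "nat \<Rightarrow> corner \<Rightarrow> corner list \<Rightarrow> corner list" where
  "emb k c v = ST_glue k (c # v)"

abbreviation "dST k \<equiv> gdist (ST\<^sub>3 k)"
abbreviation "gST k \<equiv> geo (ST\<^sub>3 k)"
abbreviation "V k \<equiv> pverts (ST\<^sub>3 k)"

text \<open>Hides which representative \<open>ST_glue\<close> selects: a junction has two names of
  equal standing, one in each of its copies.\<close>

lemma emb_eq_iff:
  "emb k c u = emb k d v \<longleftrightarrow>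
     (c = d \<and> u = v) \<or> (c \<noteq> d \<and> u = ST_extreme k d \<and> v = ST_extreme k c)"
  unfolding emb_def ST_glue_eq_iff doubleton_eq_iff by (cases c; cases d) auto

lemma emb_extreme: "emb k c (ST_extreme k c) = ST_extreme (Suc k) c"
  unfolding emb_def by (rule ST_glue_extreme)

lemma emb_extreme_swap: "emb k c (ST_extreme k d) = emb k d (ST_extreme k c)"
  by (auto simp: emb_eq_iff)

lemma verts_ST_Suc: "V (Suc k) = (\<Union>c. emb k c ` V k)"
  by (auto simp: emb_def)

lemma arcs_ST_Suc: "parcs (ST\<^sub>3 (Suc k)) = {(emb k c u, emb k c v) | c u v. (u, v) \<in> parcs (ST\<^sub>3 k)}"
  by (auto simp: emb_def)

declare ST\<^sub>3.simps [simp del] ST_extreme.simps(2) [simp del]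

lemma emb_in_verts_iff [simp]: "emb k c v \<in> V (Suc k) \<longleftrightarrow> v \<in> V k"
  by (auto simp: verts_ST_Suc emb_eq_iff ST_extreme_in_verts)

lemma extreme_in_verts [simp]: "ST_extreme k c \<in> V k"
  by (rule ST_extreme_in_verts)

lemma symmetric_ST: "symmetric (with_proj (ST\<^sub>3 k))"
proof -
  interpret pair_graph "ST\<^sub>3 k" by (rule pair_graph_ST)
  show ?thesis by (rule pair_sym_arcs)
qed

lemma arc_ST_verts: "(u, v) \<in> parcs (ST\<^sub>3 k) \<Longrightarrow> u \<in> V k \<and> v \<in> V k"
proof -
  interpret pair_graph "ST\<^sub>3 k" by (rule pair_graph_ST)
  show "(u, v) \<in> parcs (ST\<^sub>3 k) \<Longrightarrow> u \<in> V k \<and> v \<in> V k" by (auto dest: in_arcsD1 in_arcsD2)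
qed

lemma finite_verts_ST: "finite (V k)"
proof -
  interpret pair_graph "ST\<^sub>3 k" by (rule pair_graph_ST)
  show ?thesis by (rule pair_finite_verts)
qed

lemmas geo_sym_ST = geo_sym[OF symmetric_ST]
lemmas gdist_sym_ST = gdist_sym[OF symmetric_ST]

definition third :: "corner \<Rightarrow> corner \<Rightarrow> corner" where
  "third c d = (if Top \<notin> {c, d} then Top else if Left \<notin> {c, d} then Left else Right)"

lemma third_neq: "c \<noteq> d \<Longrightarrow> third c d \<noteq> c \<and> third c d \<noteq> d"
  by (cases c; cases d) (auto simp: third_def)

lemma third_eq: "distinct [c, d, e] \<Longrightarrow> third c d = e"
  by (cases c; cases d; cases e) (auto simp: third_def)

lemma UNIV_corner: "(UNIV :: corner set) = {Top, Left, Right}"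
  by (auto intro: corner.exhaust)

lemma card_UNIV_corner: "card (UNIV :: corner set) = 3"
  by (simp add: UNIV_corner)

lemma finite_corners [simp]: "finite (C :: corner set)"
  by (rule finite_subset[OF subset_UNIV]) (simp add: UNIV_corner)

lemma corner_cases3:
  fixes c d e f :: corner
  shows "distinct [c, d, e] \<Longrightarrow> f = c \<or> f = d \<or> f = e"
  by (cases c; cases d; cases e; cases f; simp)

text \<open>What the two-route description of level \<open>k + 1\<close> needs from level
  \<open>k\<close>: crossing the third copy costs exactly \<open>2 ^ k\<close>, and leaving a copy
  to return to it never pays.\<close>

definition regular :: "nat \<Rightarrow> bool" where
  "regular k \<longleftrightarrow>
     (\<forall>u\<in>V k. \<forall>v\<in>V k. gST k {} u v) \<and>
     (\<forall>u\<in>V k. \<forall>c. dST k u (ST_extreme k c) \<le> 2 ^ k) \<and>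
     (\<forall>c d. c \<noteq> d \<longrightarrow> dST k (ST_extreme k c) (ST_extreme k d) = 2 ^ k)"

definition cross_dist :: "nat \<Rightarrow> corner \<Rightarrow> corner list \<Rightarrow> corner \<Rightarrow> corner list \<Rightarrow> nat" where
  "cross_dist k c x d y =
     (if d = c then dST k x y
      else min (dST k x (ST_extreme k d) + dST k (ST_extreme k c) y)
               (dST k x (ST_extreme k (third c d)) + 2 ^ k + dST k (ST_extreme k (third c d)) y))"

text \<open>The comparisons of \<open>A\<close> and \<open>B\<close> admit only shortest routes; on
  a tie either one may be the route free of \<open>X\<close>.\<close>

definition cross_geo :: "nat \<Rightarrow> corner list set \<Rightarrow> corner \<Rightarrow> corner list \<Rightarrow> corner \<Rightarrow> corner list \<Rightarrow> bool" where
  "cross_geo k X c x d y \<longleftrightarrow>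
     (if d = c then gST k (emb k c -` X) x y
      else
        let e = third c d;
            A = dST k x (ST_extreme k d) + dST k (ST_extreme k c) y;
            B = dST k x (ST_extreme k e) + 2 ^ k + dST k (ST_extreme k e) y
        in A \<le> B \<and> gST k (emb k c -` X) x (ST_extreme k d) \<and> gST k (emb k d -` X) (ST_extreme k c) y \<or>
           B \<le> A \<and> gST k (emb k c -` X) x (ST_extreme k e) \<and>
             gST k (emb k e -` X) (ST_extreme k c) (ST_extreme k d) \<and>
             gST k (emb k d -` X) (ST_extreme k e) y)"

text \<open>
  A junction belongs to two copies; distance and geodesic condition do not depend on which
  of its two names is used.
\<close>

lemma cross_wd:
  assumes "regular k" "x \<in> V k" "emb k d y = emb k f z" "y \<in> V k" "z \<in> V k"
  shows "cross_dist k c x d y = cross_dist k c x f z \<and> (cross_geo k X c x d y \<longleftrightarrow> cross_geo k X c x f z)"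
proof (cases "d = f")
  case False
  with assms(3) have yz: "y = ST_extreme k f" "z = ST_extreme k d" by (auto simp: emb_eq_iff)
  have le: "dST k x (ST_extreme k e) \<le> 2 ^ k" for e
    using assms(1,2) by (auto simp: regular_def)
  have side: "dST k (ST_extreme k a) (ST_extreme k b) = 2 ^ k" if "a \<noteq> b" for a b
    using assms(1) that by (auto simp: regular_def)
  have sw: "emb k a (ST_extreme k b) \<in> X \<longleftrightarrow> emb k b (ST_extreme k a) \<in> X" for a b
    by (simp add: emb_extreme_swap)
  have *: "cross_dist k c x c (ST_extreme k b) = cross_dist k c x b (ST_extreme k c) \<and>
      (cross_geo k X c x c (ST_extreme k b) \<longleftrightarrow> cross_geo k X c x b (ST_extreme k c))" if "b \<noteq> c" for b
  proof -
    define e where "e = third c b"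
    have e: "e \<noteq> c" "e \<noteq> b" using that third_neq[of c b] by (auto simp: e_def)
    \<comment> \<open>A detour to a junction of the own copy crosses two full sides, while staying
      in the copy costs at most \<open>2 ^ k\<close>.\<close>
    have "dST k x (ST_extreme k b) \<le> dST k x (ST_extreme k e) + 2 ^ k + 2 ^ k"
      using le[of b] by simp
    moreover have "\<not> dST k x (ST_extreme k e) + 2 ^ k + 2 ^ k \<le> dST k x (ST_extreme k b)"
      using le[of b] zero_less_power[of "2::nat" k] by linarith
    moreover have "gST k (emb k c -` X) x (ST_extreme k b) \<Longrightarrow> emb k b (ST_extreme k c) \<notin> X"
      using geo_ends by (fastforce simp: sw)
    ultimately show ?thesis
      using that e side[of e c]
      by (auto simp: cross_dist_def cross_geo_def Let_def e_def[symmetric])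
  qed
  consider "d = c" | "f = c" | "distinct [c, d, f]" using False by auto
  then show ?thesis
  proof cases
    case 1
    then show ?thesis using *[of f] False yz by auto
  next
    case 2
    then show ?thesis using *[of d] False yz by auto
  next
    case 3
    then have t: "third c d = f" "third c f = d" using third_eq by auto
    show ?thesis using 3 side[of c d] side[of c f] side[of f d] sw[of f d]
      by (auto simp: cross_dist_def cross_geo_def Let_def t yz min.commute dest: geo_ends)
  qed
qed (use assms(3) in \<open>auto simp: emb_eq_iff\<close>)

text \<open>
  With the second part, a geodesic that follows one of the two routes stays on it as long as
  every step increases the distance.
\<close>

lemma cross_step:
  assumes "regular k" "x \<in> V k" and yz: "(y, z) \<in> parcs (ST\<^sub>3 k)"
  shows "cross_dist k c x d z \<le> cross_dist k c x d y + 1"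
    and "cross_geo k X c x d y \<Longrightarrow> emb k d z \<notin> X \<Longrightarrow>
         cross_dist k c x d z = cross_dist k c x d y + 1 \<Longrightarrow> cross_geo k X c x d z"
proof -
  have y: "y \<in> V k" and z: "z \<in> V k" using arc_ST_verts[OF yz] by auto
  have step: "dST k u z \<le> dST k u y + 1" if "u \<in> V k" for u
    using assms(1) that y z by (intro gdist_step[OF _ yz]) (auto simp: regular_def)
  note st = step[OF assms(2)] step[of "ST_extreme k c"] step[of "ST_extreme k (third c d)"]
  show "cross_dist k c x d z \<le> cross_dist k c x d y + 1"
    using st by (auto simp: cross_dist_def)
  assume cg: "cross_geo k X c x d y" and zX: "emb k d z \<notin> X"
    and eq: "cross_dist k c x d z = cross_dist k c x d y + 1"
  have ext: "gST k (emb k d -` X) u z" if "gST k (emb k d -` X) u y" "dST k u z = dST k u y + 1" for u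
    by (rule geo_extend[OF that(1) yz _ that(2)]) (use z zX in auto)
  show "cross_geo k X c x d z"
  proof (cases "d = c")
    case True
    then show ?thesis using cg eq ext by (auto simp: cross_geo_def cross_dist_def)
  next
    case False
    define e where "e = third c d"
    from cg False consider
      (A) "dST k x (ST_extreme k d) + dST k (ST_extreme k c) y \<le> dST k x (ST_extreme k e) + 2 ^ k + dST k (ST_extreme k e) y"
        "gST k (emb k c -` X) x (ST_extreme k d)" "gST k (emb k d -` X) (ST_extreme k c) y"
      | (B) "dST k x (ST_extreme k e) + 2 ^ k + dST k (ST_extreme k e) y \<le> dST k x (ST_extreme k d) + dST k (ST_extreme k c) y"
        "gST k (emb k c -` X) x (ST_extreme k e)"
             "gST k (emb k e -` X) (ST_extreme k c) (ST_extreme k d)"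
             "gST k (emb k d -` X) (ST_extreme k e) y"
      by (auto simp: cross_geo_def Let_def e_def)
    then show ?thesis
    proof cases
      case A
      with eq False st have "dST k (ST_extreme k c) z = dST k (ST_extreme k c) y + 1"
        "dST k x (ST_extreme k d) + dST k (ST_extreme k c) z \<le> dST k x (ST_extreme k e) + 2 ^ k + dST k (ST_extreme k e) z"
        by (auto simp: cross_dist_def e_def[symmetric] min_def split: if_splits)
      with A ext False show ?thesis by (auto simp: cross_geo_def Let_def e_def[symmetric])
    next
      case B
      with eq False st have "dST k (ST_extreme k e) z = dST k (ST_extreme k e) y + 1"
        "dST k x (ST_extreme k e) + 2 ^ k + dST k (ST_extreme k e) z \<le> dST k x (ST_extreme k d) + dST k (ST_extreme k c) z"
        by (auto simp: cross_dist_def e_def[symmetric] min_def split: if_splits)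
      with B ext False show ?thesis by (auto simp: cross_geo_def Let_def e_def[symmetric])
    qed
  qed
qed

text \<open>Every arc lies in one copy, so \<open>cross_dist\<close> grows by at most one per step.
  A walk of length \<open>cross_dist\<close> must gain at every step, and then
  \<open>cross_step\<close> passes its route on.\<close>

lemma cross_if_walk:
  assumes "regular k" "x \<in> V k"
    and "walk (ST\<^sub>3 (Suc k)) X (emb k c x) (emb k d y) l" "y \<in> V k"
  shows "cross_dist k c x d y \<le> l \<and> (l = cross_dist k c x d y \<longrightarrow> cross_geo k X c x d y)"
  using assms(3,4)
proof (induction l arbitrary: d y)
  case 0
  then have *: "emb k d y = emb k c x" "emb k c x \<notin> X" by auto
  from cross_wd[OF assms(1,2) *(1) 0(2) assms(2), of c X] *(2) assms(2) show ?case
    by (auto simp: cross_dist_def cross_geo_def)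
next
  case (Suc l)
  then obtain w where w: "walk (ST\<^sub>3 (Suc k)) X (emb k c x) w l"
    "(w, emb k d y) \<in> parcs (ST\<^sub>3 (Suc k))" "emb k d y \<notin> X" by auto
  from w(2) obtain f a b where f: "w = emb k f a" "emb k d y = emb k f b" "(a, b) \<in> parcs (ST\<^sub>3 k)"
    by (auto simp: arcs_ST_Suc)
  then have ab: "a \<in> V k" "b \<in> V k" using arc_ST_verts by auto
  note IH = Suc.IH[of f a] 
  note st = cross_step[OF assms(1,2) f(3), where c = c and d = f]
  have "cross_dist k c x f b \<le> Suc l \<and> (Suc l = cross_dist k c x f b \<longrightarrow> cross_geo k X c x f b)"
  proof (intro conjI impI)
    show "cross_dist k c x f b \<le> Suc l" using IH w f ab st(1) by fastforce
    assume "Suc l = cross_dist k c x f b"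
    then have "cross_dist k c x f b = cross_dist k c x f a + 1 \<and> l = cross_dist k c x f a"
      using IH w f ab st(1) by fastforce
    then show "cross_geo k X c x f b" using st(2) IH w f ab by auto
  qed
  then show ?case using cross_wd[OF assms(1,2) f(2) Suc.prems(2) ab(2), of c X] by auto
qed

lemma walk_emb:
  assumes "walk (ST\<^sub>3 k) (emb k c -` X) u v l"
  shows "walk (ST\<^sub>3 (Suc k)) X (emb k c u) (emb k c v) l"
  using assms by (rule walk_image) (auto simp: arcs_ST_Suc)

lemma walk_if_cross:
  assumes "regular k" "cross_geo k X c x d y"
  shows "walk (ST\<^sub>3 (Suc k)) X (emb k c x) (emb k d y) (cross_dist k c x d y)"
proof (cases "d = c")
  case True
  then show ?thesis using assms(2) by (auto simp: cross_geo_def cross_dist_def geo_def intro: walk_emb)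
next
  case False
  define e where "e = third c d"
  have side: "dST k (ST_extreme k c) (ST_extreme k d) = 2 ^ k"
    using assms(1) False by (auto simp: regular_def)
  from assms(2) False consider
    (A) "dST k x (ST_extreme k d) + dST k (ST_extreme k c) y \<le> dST k x (ST_extreme k e) + 2 ^ k + dST k (ST_extreme k e) y"
      "gST k (emb k c -` X) x (ST_extreme k d)" "gST k (emb k d -` X) (ST_extreme k c) y"
    | (B) "dST k x (ST_extreme k e) + 2 ^ k + dST k (ST_extreme k e) y \<le> dST k x (ST_extreme k d) + dST k (ST_extreme k c) y"
      "gST k (emb k c -` X) x (ST_extreme k e)"
           "gST k (emb k e -` X) (ST_extreme k c) (ST_extreme k d)"
           "gST k (emb k d -` X) (ST_extreme k e) y"
    by (auto simp: cross_geo_def Let_def e_def)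
  then show ?thesis
  proof cases
    case A
    from walk_trans[OF walk_emb[OF A(3)[unfolded geo_def]]]
      walk_emb[OF A(2)[unfolded geo_def]] A(1) False
    show ?thesis by (simp add: cross_dist_def e_def[symmetric] emb_extreme_swap[of k c d])
  next
    case B
    have "walk (ST\<^sub>3 (Suc k)) X (emb k c x) (emb k d (ST_extreme k e)) (dST k x (ST_extreme k e) + 2 ^ k)"
      using walk_trans[OF walk_emb[OF B(3)[unfolded geo_def]]] walk_emb[OF B(2)[unfolded geo_def]]
      by (simp add: side emb_extreme_swap[of k c e] emb_extreme_swap[of k d e])
    from walk_trans[OF walk_emb[OF B(4)[unfolded geo_def]] this] B(1) False
    show ?thesis by (simp add: cross_dist_def e_def[symmetric] min_absorb2)
  qed
qed

lemma cross_geo_empty: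
  assumes "regular k" "x \<in> V k" "y \<in> V k"
  shows "cross_geo k {} c x d y"
  using assms nat_le_linear by (auto simp: regular_def cross_geo_def Let_def)

lemma cross_if_regular:
  assumes "regular k" "x \<in> V k" "y \<in> V k"
  shows "dST (Suc k) (emb k c x) (emb k d y) = cross_dist k c x d y"
    and "gST (Suc k) X (emb k c x) (emb k d y) \<longleftrightarrow> cross_geo k X c x d y"
proof -
  show *: "dST (Suc k) (emb k c x) (emb k d y) = cross_dist k c x d y"
    using walk_if_cross[OF assms(1) cross_geo_empty[OF assms]] cross_if_walk[OF assms(1,2) _ assms(3)]
    by (intro gdist_eqI) auto
  show "gST (Suc k) X (emb k c x) (emb k d y) \<longleftrightarrow> cross_geo k X c x d y"
    using walk_if_cross[OF assms(1)] cross_if_walk[OF assms(1,2) _ assms(3)]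
    unfolding geo_def * by blast
qed

section \<open>The invariant \<open>regular\<close> at all levels\<close>

lemma ST_0: "V 0 = range (\<lambda>c. [c])" "([c], [d]) \<in> parcs (ST\<^sub>3 0) \<longleftrightarrow> c \<noteq> d"
  by (cases c; cases d; auto simp: ST\<^sub>3.simps Let_def intro: corner.exhaust)+

lemma walk_ST_0: "walk (ST\<^sub>3 0) X [c] [d] (if c = d then 0 else 1) \<longleftrightarrow> [c] \<notin> X \<and> [d] \<notin> X"
  by (auto simp: ST_0)

lemma dist_ST_0: "dST 0 [c] [d] = (if c = d then 0 else 1)"
proof (rule gdist_eqI)
  show "walk (ST\<^sub>3 0) {} [c] [d] (if c = d then 0 else 1)" by (simp only: walk_ST_0) simp
  fix l assume "walk (ST\<^sub>3 0) {} [c] [d] l"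
  then show "(if c = d then 0 else 1) \<le> l" by (cases l) auto
qed

lemma geo_ST_0: "gST 0 X [c] [d] \<longleftrightarrow> [c] \<notin> X \<and> [d] \<notin> X"
  unfolding geo_def dist_ST_0 walk_ST_0 ..

lemma regular_0: "regular 0"
  by (auto simp: regular_def ST_0 dist_ST_0 geo_ST_0)

lemma regular_Suc:
  assumes "regular k" shows "regular (Suc k)"
  unfolding regular_def
proof (intro conjI ballI allI impI)
  have le: "dST k u (ST_extreme k c) \<le> 2 ^ k" "dST k (ST_extreme k c) u \<le> 2 ^ k" if "u \<in> V k" for u c
    using assms that by (auto simp: regular_def gdist_sym_ST[of k "ST_extreme k c" u])
  have side: "dST k (ST_extreme k a) (ST_extreme k b) = 2 ^ k" if "a \<noteq> b" for a b
    using assms that by (auto simp: regular_def)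
  fix u assume "u \<in> V (Suc k)"
  then obtain c x where u: "u = emb k c x" "x \<in> V k" by (auto simp: verts_ST_Suc)
  show "dST (Suc k) u (ST_extreme (Suc k) d) \<le> 2 ^ Suc k" for d
    using le[OF u(2), of d] le(2)[of "ST_extreme k d" c]
    by (auto simp: u cross_if_regular[OF assms] cross_dist_def emb_extreme[symmetric])
  fix v assume "v \<in> V (Suc k)"
  then obtain d y where v: "v = emb k d y" "y \<in> V k" by (auto simp: verts_ST_Suc)
  show "gST (Suc k) {} u v"
    using u v cross_geo_empty[OF assms] by (auto simp: cross_if_regular[OF assms])
next
  fix c d :: corner assume "c \<noteq> d"
  then show "dST (Suc k) (ST_extreme (Suc k) c) (ST_extreme (Suc k) d) = 2 ^ Suc k"
    using assms third_neq[of c d]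
    by (auto simp: emb_extreme[symmetric] cross_if_regular[OF assms] cross_dist_def regular_def)
qed

lemma regular: "regular k"
  by (induction k) (auto intro: regular_0 regular_Suc)

lemmas geo_empty_ST = regular[unfolded regular_def, THEN conjunct1, rule_format]
  and dist_extreme_le = regular[unfolded regular_def, THEN conjunct2, THEN conjunct1, rule_format]
  and dist_extremes = regular[unfolded regular_def, THEN conjunct2, THEN conjunct2, rule_format]

subsection \<open>Outer mutual-visibility sets in the copies\<close>

declare ST_extreme.simps [simp del]

abbreviation "del k x c \<equiv> gdist (ST\<^sub>3 k) x (ST_extreme k c)"

lemma dist_same:
  "x \<in> V k \<Longrightarrow> y \<in> V k \<Longrightarrow> dST (Suc k) (emb k c x) (emb k c y) = dST k x y"
  by (simp add: cross_if_regular[OF regular] cross_dist_def)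

lemma geo_same:
  "x \<in> V k \<Longrightarrow> y \<in> V k \<Longrightarrow> gST (Suc k) X (emb k c x) (emb k c y) \<longleftrightarrow> gST k (emb k c -` X) x y"
  by (simp add: cross_if_regular[OF regular] cross_geo_def)

lemma geo_cross:
  assumes "distinct [c, d, e]" "x \<in> V k" "y \<in> V k"
  shows "gST (Suc k) X (emb k c x) (emb k d y) \<longleftrightarrow>
    del k x d + del k y c \<le> del k x e + 2 ^ k + del k y e \<and>
      gST k (emb k c -` X) x (ST_extreme k d) \<and> gST k (emb k d -` X) (ST_extreme k c) y \<or>
    del k x e + 2 ^ k + del k y e \<le> del k x d + del k y c \<and>
      gST k (emb k c -` X) x (ST_extreme k e) \<and>
      gST k (emb k e -` X) (ST_extreme k c) (ST_extreme k d) \<and>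
      gST k (emb k d -` X) (ST_extreme k e) y"
proof -
  have "d \<noteq> c" "third c d = e" using assms(1) third_eq by auto
  then show ?thesis using assms(2,3)
    by (simp add: cross_if_regular[OF regular] cross_geo_def Let_def
        gdist_sym_ST[of k "ST_extreme k _" y])
qed

lemma del_extremes [simp]: "c \<noteq> d \<Longrightarrow> del k (ST_extreme k c) d = 2 ^ k"
  by (rule dist_extremes)

lemma del_eq_0_iff: "x \<in> V k \<Longrightarrow> del k x c = 0 \<longleftrightarrow> x = ST_extreme k c"
  by (simp add: gdist_eq_0_iff geo_empty_ST)

lemma del_triangle:
  assumes "x \<in> V k" shows "del k x c \<le> del k x d + 2 ^ k"
proof (cases "c = d")
  case False
  with gdist_triangle[OF geo_empty_ST[OF assms] geo_empty_ST, of "ST_extreme k d" "ST_extreme k c"]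
  show ?thesis by simp
qed simp

text \<open>Since \<open>del k x c\<close> is at most \<open>2 ^ k\<close>, no room is left for a
  positive distance to \<open>d\<close>.\<close>

lemma extreme_if_del: "x \<in> V k \<Longrightarrow> del k x d + 2 ^ k \<le> del k x c \<Longrightarrow> x = ST_extreme k d"
  using dist_extreme_le[of x k c] by (simp add: del_eq_0_iff[symmetric])

text \<open>From another copy, the direct route passes the junction and then one full side. The
  detour passes two full sides and cannot win, as \<open>del k x d\<close> is at most
  \<open>2 ^ k\<close>.\<close>

lemma del_Suc:
  assumes "x \<in> V k"
  shows "del (Suc k) (emb k c x) d = del k x d + (if c = d then 0 else 2 ^ k)"
proof (cases "c = d")
  case False
  with third_neq[OF False] dist_extreme_le[OF assms, of d] show ?thesis using assms
    by (simp add: emb_extreme[symmetric] cross_if_regular[OF regular] cross_dist_def)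
qed (use assms in \<open>simp add: emb_extreme[symmetric] dist_same\<close>)

lemma vimage_emb_Diff: "emb k c -` (M - {emb k c x, emb k c y}) = emb k c -` M - {x, y}"
  by (auto simp: emb_eq_iff)

lemma vimage_emb_insert_extreme:
  "emb k c -` insert (ST_extreme (Suc k) e) X =
     (if c = e then insert (ST_extreme k e) (emb k c -` X) else emb k c -` X)"
  by (auto simp: emb_extreme[symmetric] emb_eq_iff)

text \<open>Extreme vertices are never interior to a geodesic.\<close>

lemma geo_insert_extreme:
  "gST k X u v \<Longrightarrow> ST_extreme k e \<notin> {u, v} \<Longrightarrow> gST k (insert (ST_extreme k e) X) u v"
proof (induction k arbitrary: X u v)
  case 0
  then have "u \<in> V 0" "v \<in> V 0" by (auto dest: geo_ends)
  then obtain c d where "u = [c]" "v = [d]" by (auto simp: ST_0)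
  with 0 show ?case by (auto simp: geo_ST_0 ST_extreme.simps)
next
  case (Suc k)
  from Suc.prems(1) have "u \<in> V (Suc k)" "v \<in> V (Suc k)" by (auto dest: geo_ends)
  then obtain c x d y where u: "u = emb k c x" "x \<in> V k" and v: "v = emb k d y" "y \<in> V k"
    by (auto simp: verts_ST_Suc)
  have ne: "c = e \<Longrightarrow> x \<noteq> ST_extreme k e" "d = e \<Longrightarrow> y \<noteq> ST_extreme k e"
    using Suc.prems(2) u v by (auto simp: emb_extreme)
  show ?case
  proof (cases "c = d")
    case True
    with Suc ne u v show ?thesis
      by (auto simp: geo_same vimage_emb_insert_extreme)
  next
    case False
    define f where "f = third c d"
    have f: "distinct [c, d, f]" using third_neq[OF False] False by (auto simp: f_def)
    show ?thesis
      using Suc.prems(1) ne f unfolding u(1) v(1) geo_cross[OF f u(2) v(2)] vimage_emb_insert_extreme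
      by (elim disj_forward conj_forward) (auto intro!: Suc.IH)
  qed
qed

text \<open>
  Since extreme vertices are harmless, one that sees everything in spite of \<open>M\<close> can be
  added to \<open>M\<close>; so seeing an extreme vertex improves a cardinality bound by one.
\<close>

definition sees :: "nat \<Rightarrow> corner list set \<Rightarrow> corner list \<Rightarrow> bool" where
  "sees k M u \<longleftrightarrow> (\<forall>v\<in>V k. gST k (M - {u, v}) u v)"

definition OV :: "nat \<Rightarrow> corner list set \<Rightarrow> bool" where
  "OV k M \<longleftrightarrow> M \<subseteq> V k \<and> (\<forall>u\<in>M. sees k M u)"

lemma OV_iff: "outer_mutual_visibility_set (ST\<^sub>3 k) M \<longleftrightarrow> OV k M"
  unfolding outer_mutual_visibility_set_iff OV_def sees_def ..

lemma OV_finite: "OV k M \<Longrightarrow> finite M"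
  unfolding OV_def using finite_verts_ST finite_subset by blast

lemma sees_insert_extreme: "sees k M u \<Longrightarrow> sees k (insert (ST_extreme k e) M) u"
  unfolding sees_def
proof (intro ballI)
  fix v assume "\<forall>v\<in>V k. gST k (M - {u, v}) u v" "v \<in> V k"
  then have g: "gST k (M - {u, v}) u v" by simp
  show "gST k (insert (ST_extreme k e) M - {u, v}) u v"
  proof (cases "ST_extreme k e \<in> {u, v}")
    case True
    then have "insert (ST_extreme k e) M - {u, v} = M - {u, v}" by blast
    with g show ?thesis by simp
  next
    case False
    with geo_insert_extreme[OF g, of e] show ?thesis by (simp add: insert_Diff_if)
  qed
qed

lemma OV_insert_extreme: "OV k M \<Longrightarrow> sees k M (ST_extreme k e) \<Longrightarrow> OV k (insert (ST_extreme k e) M)"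
  by (auto simp: OV_def intro: sees_insert_extreme)

text \<open>Adding an extreme vertex destroys no view, so they can be added one by one; the
  induction carries \<open>sees\<close> along for all vertices.\<close>

lemma OV_Un_extremes:
  assumes "OV k M" "\<And>c. c \<in> C \<Longrightarrow> sees k M (ST_extreme k c)"
  shows "OV k (M \<union> ST_extreme k ` C)"
proof -
  have "finite C" by simp
  then have "OV k (M \<union> ST_extreme k ` C) \<and> (\<forall>u. sees k M u \<longrightarrow> sees k (M \<union> ST_extreme k ` C) u)"
    using assms(2)
  proof induction
    case empty
    then show ?case using assms(1) by simp
  next
    case (insert c C)
    then show ?case using OV_insert_extreme sees_insert_extreme by simp
  qed
  then show ?thesis ..
qed

text \<open>By \<open>geo_same\<close>, geodesics between vertices of one copy may be sought inside
  that copy.\<close>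

lemma OV_emb:
  assumes "OV (Suc k) M" shows "OV k (emb k c -` M)"
proof -
  have sub: "emb k c -` M \<subseteq> V k" using assms by (auto simp: OV_def)
  moreover have "gST k (emb k c -` M - {u, v}) u v" if u: "emb k c u \<in> M" and v: "v \<in> V k" for u v
  proof -
    have "gST (Suc k) (M - {emb k c u, emb k c v}) (emb k c u) (emb k c v)"
      using assms u v by (simp add: OV_def sees_def)
    moreover have "u \<in> V k" using sub u by auto
    ultimately show ?thesis using v by (simp add: geo_same vimage_emb_Diff)
  qed
  ultimately show ?thesis by (simp add: OV_def sees_def)
qed

text \<open>Look from \<open>x\<close> in copy \<open>c\<close> at the outer corner of copy
  \<open>d\<close>. The junction blocks the direct route unless it is \<open>x\<close> itself, and
  the detour is short enough only from the other junction of \<open>c\<close>.\<close>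

lemma OV_junction:
  assumes "OV (Suc k) M" "distinct [c, d, e]" "emb k c (ST_extreme k d) \<in> M"
  shows "emb k c -` M \<subseteq> {ST_extreme k d, ST_extreme k e}"
proof
  fix x assume x: "x \<in> emb k c -` M"
  then have xV: "x \<in> V k" using OV_emb[OF assms(1)] by (auto simp: OV_def)
  show "x \<in> {ST_extreme k d, ST_extreme k e}"
  proof (rule ccontr)
    assume n: "x \<notin> {ST_extreme k d, ST_extreme k e}"
    have "gST (Suc k) (M - {emb k c x, emb k d (ST_extreme k d)}) (emb k c x) (emb k d (ST_extreme k d))"
      using assms(1) x by (auto simp: OV_def sees_def)
    moreover have "ST_extreme k d \<in> emb k c -` (M - {emb k c x, emb k d (ST_extreme k d)})"
      using assms(2,3) n by (auto simp: emb_eq_iff)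
    then have "\<not> gST k (emb k c -` (M - {emb k c x, emb k d (ST_extreme k d)})) x (ST_extreme k d)"
      by (auto dest: geo_ends)
    ultimately have "del k x e + 2 ^ k + 2 ^ k \<le> del k x d + 2 ^ k"
      using assms(2) by (auto simp: geo_cross[OF assms(2) xV])
    then show False using extreme_if_del[OF xV, of e d] n by simp
  qed
qed

section \<open>Counting by copies, and the effect of blocked corners\<close>

definition no_junction :: "nat \<Rightarrow> corner list set \<Rightarrow> bool" where
  "no_junction k M \<longleftrightarrow> (\<forall>c d. c \<noteq> d \<longrightarrow> emb k c (ST_extreme k d) \<notin> M)"

lemma Un_copies:
  assumes "M \<subseteq> V (Suc k)" "distinct [c, d, e]"
  shows "M = emb k c ` (emb k c -` M) \<union> emb k d ` (emb k d -` M) \<union> emb k e ` (emb k e -` M)"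
proof
  show "M \<subseteq> emb k c ` (emb k c -` M) \<union> emb k d ` (emb k d -` M) \<union> emb k e ` (emb k e -` M)"
  proof
    fix v assume "v \<in> M"
    with assms(1) obtain f x where "v = emb k f x" "x \<in> V k" by (auto simp: verts_ST_Suc)
    then show "v \<in> emb k c ` (emb k c -` M) \<union> emb k d ` (emb k d -` M) \<union> emb k e ` (emb k e -` M)"
      using corner_cases3[OF assms(2), of f] \<open>v \<in> M\<close> by auto
  qed
qed auto

lemma card_le_copies:
  assumes "OV (Suc k) M" "distinct [c, d, e]"
  shows "card M \<le> card (emb k c -` M) + card (emb k d -` M) + card (emb k e -` M)"
proof -
  have fin: "finite (emb k f -` M)" for f using OV_emb[OF assms(1)] by (rule OV_finite)
  have "card M = card (emb k c ` (emb k c -` M) \<union> emb k d ` (emb k d -` M) \<union> emb k e ` (emb k e -` M))"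
    using Un_copies[OF _ assms(2), of M k] assms(1) by (simp add: OV_def)
  also have "\<dots> \<le> card (emb k c ` (emb k c -` M)) + card (emb k d ` (emb k d -` M)) + card (emb k e ` (emb k e -` M))"
    by (meson add_le_mono card_Un_le le_refl order_trans)
  also have "\<dots> \<le> card (emb k c -` M) + card (emb k d -` M) + card (emb k e -` M)"
    by (intro add_mono card_image_le fin)
  finally show ?thesis .
qed

lemma Un3_least: "A \<subseteq> S \<Longrightarrow> B \<subseteq> S \<Longrightarrow> C \<subseteq> S \<Longrightarrow> A \<union> B \<union> C \<subseteq> S"
  by (rule Un_least[OF Un_least])

text \<open>The copies \<open>c\<close> and \<open>d\<close> contribute junctions only. With a
  second junction in \<open>M\<close> the copy \<open>e\<close> does so too; otherwise the junction
  is the only point outside the part in \<open>e\<close>.\<close>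

lemma card_junction:
  assumes "OV (Suc k) M" "distinct [c, d, e]" "emb k c (ST_extreme k d) \<in> M"
  shows "card M \<le> 3 \<or> card M \<le> 1 + card (emb k e -` M)"
proof -
  let ?j = "\<lambda>a b. emb k a (ST_extreme k b)"
  have dist: "distinct [d, c, e]" "distinct [c, e, d]" "distinct [d, e, c]" "distinct [e, c, d]" "distinct [e, d, c]"
    using assms(2) by auto
  have sw: "?j a b = ?j b a" for a b by (rule emb_extreme_swap)
  have c: "emb k c -` M \<subseteq> {ST_extreme k d, ST_extreme k e}"
    using OV_junction[OF assms] .
  have d: "emb k d -` M \<subseteq> {ST_extreme k c, ST_extreme k e}"
    using OV_junction[OF assms(1) dist(1)] assms(3) unfolding sw[of c d] by simp
  have M: "M \<subseteq> V (Suc k)" using assms(1) by (simp add: OV_def)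
  note dec = Un_copies[OF M assms(2)]
  show ?thesis
  proof (cases "?j c e \<in> M \<or> ?j d e \<in> M")
    case True
    then have "?j e c \<in> M \<or> ?j e d \<in> M" unfolding sw[of e c] sw[of e d] .
    then have "emb k e -` M \<subseteq> {ST_extreme k c, ST_extreme k d}"
      using OV_junction[OF assms(1) dist(4)] OV_junction[OF assms(1) dist(5)] by blast
    from this[THEN image_mono, of "emb k e"] c[THEN image_mono, of "emb k c"] d[THEN image_mono, of "emb k d"]
    have "emb k c ` (emb k c -` M) \<union> emb k d ` (emb k d -` M) \<union> emb k e ` (emb k e -` M)
        \<subseteq> {?j c d, ?j c e, ?j d e}"
      by (intro Un3_least; elim subset_trans; use assms(2) dist in \<open>simp add: emb_eq_iff\<close>)
    then have "M \<subseteq> {?j c d, ?j c e, ?j d e}" unfolding dec[symmetric] .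
    then have "card M \<le> card {?j c d, ?j c e, ?j d e}" by (intro card_mono) simp_all
    also have "\<dots> \<le> 3" using card_length[of "[?j c d, ?j c e, ?j d e]"] by simp
    finally show ?thesis ..
  next
    case False
    with c d have "emb k c -` M \<subseteq> {ST_extreme k d}" "emb k d -` M \<subseteq> {ST_extreme k c}" by blast+
    from this[THEN image_mono, of "emb k c"] this[THEN image_mono, of "emb k d"]
    have "emb k c ` (emb k c -` M) \<subseteq> {?j c d}" "emb k d ` (emb k d -` M) \<subseteq> {?j c d}"
      using assms(2) by (simp_all only: image_insert image_empty) (simp_all add: sw[of c d])
    then have "emb k c ` (emb k c -` M) \<union> emb k d ` (emb k d -` M) \<union> emb k e ` (emb k e -` M)
        \<subseteq> insert (?j c d) (emb k e ` (emb k e -` M))"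
      by (intro Un3_least) ((erule subset_trans, simp)+, rule subset_insertI)
    then have "M \<subseteq> insert (?j c d) (emb k e ` (emb k e -` M))" unfolding dec[symmetric] .
    moreover have fin: "finite (emb k e -` M)" using OV_finite[OF OV_emb[OF assms(1)]] .
    ultimately have "card M \<le> card (insert (?j c d) (emb k e ` (emb k e -` M)))"
      by (intro card_mono finite.insertI finite_imageI)
    also have "\<dots> \<le> Suc (card (emb k e ` (emb k e -` M)))" using finite_imageI[OF fin, of "emb k e"] by (simp only: card_insert_if) simp
    also have "\<dots> \<le> 1 + card (emb k e -` M)" using card_image_le[OF fin, of "emb k e"] by (simp only: plus_1_eq_Suc Suc_le_mono)
    finally show ?thesis ..
  qed
qed

text \<open>The direct route from \<open>x\<close> to \<open>y\<close> would need a free geodesic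
  from the junction to \<open>y\<close>, so visibility has to use the detour, which must then be no
  longer.\<close>

lemma detour_if_blocked:
  assumes "OV (Suc k) M" "no_junction k M" "distinct [c, d, e]" "emb k c x \<in> M" "y \<in> V k"
    and "\<not> gST k (emb k d -` M - {ST_extreme k c, y}) (ST_extreme k c) y"
  shows "del k x e + 2 ^ k + del k y e \<le> del k x d + del k y c"
proof -
  let ?X = "M - {emb k c x, emb k d y}"
  have x: "x \<in> V k" using assms(1,4) by (auto simp: OV_def)
  have sub: "emb k d -` M - {ST_extreme k c, y} \<subseteq> emb k d -` ?X"
  proof
    fix z assume z: "z \<in> emb k d -` M - {ST_extreme k c, y}"
    have "x \<noteq> ST_extreme k d" using assms(2,3,4) by (auto simp: no_junction_def)
    moreover have "d \<noteq> c" using assms(3) by auto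
    ultimately show "z \<in> emb k d -` ?X" using z by (simp add: emb_eq_iff)
  qed
  have "\<not> gST k (emb k d -` ?X) (ST_extreme k c) y"
    using assms(6) geo_antimono[OF _ sub] by (rule contrapos_nn)
  moreover have "gST (Suc k) ?X (emb k c x) (emb k d y)"
    using assms(1,4,5) by (simp add: OV_def sees_def)
  ultimately show ?thesis by (auto simp: geo_cross[OF assms(3) x assms(5)])
qed

text \<open>
  Near the corner \<open>e\<close>, the vertices of the side towards \<open>c\<close> are \<open>e, a, b, \<dots>\<close>, and
  \<open>a\<close> lies on the only geodesic from \<open>e\<close> to \<open>b\<close>.
\<close>

lemma side_end:
  assumes "c \<noteq> e"
  shows "\<exists>a\<in>V (Suc k). \<exists>b\<in>V (Suc k). (a, ST_extreme (Suc k) e) \<in> parcs (ST\<^sub>3 (Suc k)) \<and>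
    del (Suc k) a c + 1 = 2 ^ Suc k \<and> del (Suc k) b c + 2 = 2 ^ Suc k \<and> del (Suc k) b e = 2 \<and>
    (\<forall>X. gST (Suc k) X (ST_extreme (Suc k) e) b \<longrightarrow> a \<notin> X)"
proof (induction k)
  case 0
  define f where "f = third e c"
  have f: "distinct [e, c, f]" using third_neq[of e c] assms by (auto simp: f_def)
  have "(ST_extreme 0 c, ST_extreme 0 e) \<in> parcs (ST\<^sub>3 0)" using assms by (simp add: ST_0 ST_extreme.simps)
  then have "(emb 0 e (ST_extreme 0 c), ST_extreme (Suc 0) e) \<in> parcs (ST\<^sub>3 (Suc 0))"
    unfolding emb_extreme[symmetric] arcs_ST_Suc by blast
  moreover have "emb 0 e (ST_extreme 0 c) \<notin> X"
    if "gST (Suc 0) X (ST_extreme (Suc 0) e) (ST_extreme (Suc 0) c)" for X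
  proof -
    have "del 0 (ST_extreme 0 e) c = 1" "del 0 (ST_extreme 0 e) f = 1" "del 0 (ST_extreme 0 c) f = 1"
      "del 0 (ST_extreme 0 c) e = 1"
      using f by (auto simp: dist_ST_0 ST_extreme.simps)
    with that have "gST 0 (emb 0 e -` X) (ST_extreme 0 e) (ST_extreme 0 c)"
      unfolding emb_extreme[symmetric] geo_cross[OF f extreme_in_verts extreme_in_verts] by (elim disjE conjE) simp_all
    then show ?thesis by (auto dest: geo_ends)
  qed
  moreover have "del (Suc 0) (emb 0 e (ST_extreme 0 c)) c = 1"
    using assms del_Suc[OF extreme_in_verts, of 0 e c c] by simp
  moreover have "del (Suc 0) (ST_extreme (Suc 0) c) e = 2" using assms by (subst del_extremes) auto
  ultimately show ?case
    by (intro bexI[of _ "emb 0 e (ST_extreme 0 c)"] bexI[of _ "ST_extreme (Suc 0) c"]) simp_all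
next
  case (Suc k)
  then obtain a b where ab: "a \<in> V (Suc k)" "b \<in> V (Suc k)" "(a, ST_extreme (Suc k) e) \<in> parcs (ST\<^sub>3 (Suc k))"
    "del (Suc k) a c + 1 = 2 ^ Suc k" "del (Suc k) b c + 2 = 2 ^ Suc k" "del (Suc k) b e = 2"
    "\<And>X. gST (Suc k) X (ST_extreme (Suc k) e) b \<Longrightarrow> a \<notin> X" by blast
  let ?a = "emb (Suc k) e a" and ?b = "emb (Suc k) e b"
  have "(?a, ST_extreme (Suc (Suc k)) e) \<in> parcs (ST\<^sub>3 (Suc (Suc k)))"
    unfolding emb_extreme[of "Suc k", symmetric] arcs_ST_Suc[of "Suc k"] using ab(3) by blast
  moreover have "?a \<notin> X" if "gST (Suc (Suc k)) X (ST_extreme (Suc (Suc k)) e) ?b" for X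
    using that ab(2,7) unfolding emb_extreme[of "Suc k", symmetric] by (auto simp: geo_same)
  moreover have "del (Suc (Suc k)) ?a c + 1 = 2 ^ Suc (Suc k)" "del (Suc (Suc k)) ?b c + 2 = 2 ^ Suc (Suc k)"
    "del (Suc (Suc k)) ?b e = 2"
    unfolding del_Suc[OF ab(1)] del_Suc[OF ab(2)] using ab(4,5,6) assms by simp_all
  ultimately show ?case using ab(1,2) by (intro bexI[of _ ?a] bexI[of _ ?b]) auto
qed

text \<open>A blocked target other than corner \<open>e\<close> makes the detour inequality strict
  at once. If it is corner \<open>e\<close>, the inequality is only weak, so the vertices
  \<open>a\<close> and \<open>b\<close> next to that corner are tried as well.\<close>

lemma pushed_if_blocked:
  assumes "OV (Suc k) M" "no_junction k M" "distinct [c, d, e]" "k \<ge> 2"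
    and nonempty: "emb k e -` M \<noteq> {}" 
    and blocked: "\<not> sees k (emb k d -` M) (ST_extreme k c)" and x: "emb k c x \<in> M"
  shows "del k x e < del k x d"
proof -
  from blocked obtain y where y: "y \<in> V k"
    "\<not> gST k (emb k d -` M - {ST_extreme k c, y}) (ST_extreme k c) y" by (auto simp: sees_def)
  note det = detour_if_blocked[OF assms(1-3) x]
  show ?thesis
  proof (cases "y = ST_extreme k e")
    case False
    then have "del k y c < del k y e + 2 ^ k" using extreme_if_del[OF y(1), of e c] by linarith
    with det[OF y] show ?thesis by linarith
  next
    case True
    have Md: "ST_extreme k c \<notin> emb k d -` M" "ST_extreme k e \<notin> emb k d -` M"
      using assms(2,3) by (auto simp: no_junction_def)
    with y(2) True have nce: "\<not> gST k (emb k d -` M) (ST_extreme k c) (ST_extreme k e)"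
      using insert_absorb by auto
    obtain a b where ab: "a \<in> V k" "b \<in> V k" "(a, ST_extreme k e) \<in> parcs (ST\<^sub>3 k)"
      "del k a c + 1 = 2 ^ k" "del k b c + 2 = 2 ^ k" "del k b e = 2"
      "\<And>X. gST k X (ST_extreme k e) b \<Longrightarrow> a \<notin> X"
      using side_end[of c e "k - 1"] assms(3,4) by auto
    show ?thesis
    proof (cases "gST k (emb k d -` M - {ST_extreme k c, a}) (ST_extreme k c) a")
      case False
      from det[OF ab(1) this] ab(4) show ?thesis by linarith
    next
      case True
      have "gST k (emb k d -` M - {ST_extreme k c, a}) (ST_extreme k c) (ST_extreme k e)"
        using assms(3) ab(4) Md
        by (intro geo_extend[OF True ab(3)]) (auto simp: gdist_sym_ST[of k "ST_extreme k c" a])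
      \<comment> \<open>Otherwise the geodesic extended from \<open>a\<close> would reach corner
        \<open>e\<close> free of the set.\<close>
      with nce Md have "a \<in> emb k d -` M" by (metis Diff_insert0 Diff_empty Diff_insert2)
      moreover have "a \<noteq> ST_extreme k e" "a \<noteq> b" using ab Md calculation by auto
      ultimately have nb: "\<not> gST k (emb k d -` M - {ST_extreme k e, b}) (ST_extreme k e) b"
        using ab(7) by blast
      \<comment> \<open>As \<open>b\<close> is blocked from corner \<open>e\<close> of copy
        \<open>d\<close>, the point \<open>z\<close> of copy \<open>e\<close> needs the detour
        through \<open>c\<close> to reach \<open>b\<close>. With \<open>2 ^ k\<close> at least 4,
        this forces \<open>z\<close> to be a junction.\<close>
      from nonempty obtain z where z: "emb k e z \<in> M" by auto
      then have zV: "z \<in> V k" using assms(1) by (auto simp: OV_def)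
      have "distinct [e, d, c]" using assms(3) by auto
      from detour_if_blocked[OF assms(1,2) this z ab(2) nb]
      have "del k z c + 2 ^ k + del k b c \<le> del k z d + 2" using ab(6) by simp
      moreover have "(2::nat) ^ 2 \<le> 2 ^ k" using assms(4) by (rule power_increasing) simp
      ultimately have "del k z c + 2 ^ k \<le> del k z d" using ab(5) by simp
      then have "z = ST_extreme k c" by (rule extreme_if_del[OF zV])
      with z assms(2,3) show ?thesis by (auto simp: no_junction_def)
    qed
  qed
qed

subsection \<open>The induction step of the upper bound\<close>

lemma card_Un_extremes:
  assumes "OV k N" "\<And>c. c \<in> C \<Longrightarrow> ST_extreme k c \<notin> N"
  shows "card (N \<union> ST_extreme k ` C) = card N + card C"
proof -
  have "card (ST_extreme k ` C) = card C" by (rule card_image) (auto simp: inj_on_def)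
  then show ?thesis using assms OV_finite[OF assms(1)]
    by (subst card_Un_disjoint) auto
qed

text \<open>The exception for corner \<open>t\<close> allows this corner to be added to a leaning
  set.\<close>

definition leans :: "nat \<Rightarrow> corner \<Rightarrow> corner \<Rightarrow> corner list set \<Rightarrow> bool" where
  "leans k t r N \<longleftrightarrow> (\<forall>x\<in>N. x = ST_extreme k t \<or> del k x r < del k x t)"

definition OV_bound :: "nat \<Rightarrow> nat \<Rightarrow> bool" where
  "OV_bound k B \<longleftrightarrow> (\<forall>N. OV k N \<longrightarrow> card N \<le> B)"

definition leaning_bound :: "nat \<Rightarrow> nat \<Rightarrow> bool" where
  "leaning_bound k B \<longleftrightarrow> (\<forall>N t r. t \<noteq> r \<longrightarrow> OV k N \<longrightarrow> leans k t r N \<longrightarrow> card N \<le> B)"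

text \<open>The corners \<open>d\<close> and \<open>e\<close> of copy \<open>c\<close> are
  junctions, hence outside \<open>M\<close>, so each of them with full view adds exactly one
  point.\<close>

lemma OV_extend_copy:
  assumes "OV (Suc k) M" "no_junction k M" "distinct [c, d, e]"
  obtains C where "C \<subseteq> {d, e}" "OV k (emb k c -` M \<union> ST_extreme k ` C)"
    "card (emb k c -` M \<union> ST_extreme k ` C) =
       card (emb k c -` M) + of_bool (sees k (emb k c -` M) (ST_extreme k d))
                         + of_bool (sees k (emb k c -` M) (ST_extreme k e))"
proof
  let ?N = "emb k c -` M"
  let ?C = "(if sees k ?N (ST_extreme k d) then {d} else {}) \<union>
      (if sees k ?N (ST_extreme k e) then {e} else {})"
  show "?C \<subseteq> {d, e}" by auto
  show "OV k (?N \<union> ST_extreme k ` ?C)"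
    by (rule OV_Un_extremes[OF OV_emb[OF assms(1)]]) (auto split: if_splits)
  have "ST_extreme k f \<notin> ?N" if "f \<in> ?C" for f
    using that assms(2,3) by (auto simp: no_junction_def split: if_splits)
  then have "card (?N \<union> ST_extreme k ` ?C) = card ?N + card ?C"
    by (rule card_Un_extremes[OF OV_emb[OF assms(1)]])
  also have "card ?C = of_bool (sees k ?N (ST_extreme k d)) + of_bool (sees k ?N (ST_extreme k e))"
    using assms(3) by auto
  finally show "card (?N \<union> ST_extreme k ` ?C) = card ?N + of_bool (sees k ?N (ST_extreme k d))
      + of_bool (sees k ?N (ST_extreme k e))" by simp
qed

lemma copy_bound:
  assumes "OV_bound k B" "OV (Suc k) M" "no_junction k M" "distinct [c, d, e]"
  shows "card (emb k c -` M) + of_bool (sees k (emb k c -` M) (ST_extreme k d))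
                         + of_bool (sees k (emb k c -` M) (ST_extreme k e)) \<le> B"
  using OV_extend_copy[OF assms(2-4)] assms(1) by (metis OV_bound_def)

lemma leaning_copy_bound:
  assumes "leaning_bound k B" "OV (Suc k) M" "no_junction k M" "distinct [c, d, e]"
    and lean: "leans k d e (emb k c -` M)"
  shows "card (emb k c -` M) + of_bool (sees k (emb k c -` M) (ST_extreme k d))
                         + of_bool (sees k (emb k c -` M) (ST_extreme k e)) \<le> B"
proof -
  from OV_extend_copy[OF assms(2-4)] obtain C where C: "C \<subseteq> {d, e}" "OV k (emb k c -` M \<union> ST_extreme k ` C)"
    "card (emb k c -` M \<union> ST_extreme k ` C) =
       card (emb k c -` M) + of_bool (sees k (emb k c -` M) (ST_extreme k d))
                         + of_bool (sees k (emb k c -` M) (ST_extreme k e))" .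
  have "leans k d e (emb k c -` M \<union> ST_extreme k ` C)"
    unfolding leans_def
  proof
    fix x assume "x \<in> emb k c -` M \<union> ST_extreme k ` C"
    with C(1) consider "x \<in> emb k c -` M" | "x = ST_extreme k d" | "x = ST_extreme k e" by blast
    then show "x = ST_extreme k d \<or> del k x e < del k x d"
      by cases (use lean assms(4) in \<open>auto simp: leans_def\<close>)
  qed
  moreover have "d \<noteq> e" using assms(4) by simp
  ultimately show ?thesis using C(2,3) assms(1) unfolding leaning_bound_def by metis
qed

text \<open>
  If \<open>M\<close> blocks the copy \<open>d\<close> from its corner towards \<open>c\<close>, then the part of \<open>M\<close> in \<open>c\<close>
  is pushed towards \<open>e\<close>. The bonus that \<open>d\<close> gains from being blocked is thus paid for by \<open>c\<close>,
  and \<open>c\<close> pays at most once because it cannot lean in both directions.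
\<close>

lemma copy_balance:
  assumes "OV (Suc k) M" "no_junction k M" "k \<ge> 2" and dist: "distinct [c, d, e]"
    and nonempty: "\<And>f. emb k f -` M \<noteq> {}"
    and bounds: "OV_bound k (b + 3)" "leaning_bound k (b + 2)"
  defines "s \<equiv> \<lambda>f g. sees k (emb k f -` M) (ST_extreme k g)"
  shows "card (emb k c -` M) + of_bool (s c d) + of_bool (s c e)
    + of_bool (\<not> s d c) + of_bool (\<not> s e c) \<le> b + 3"
proof -
  have dist': "distinct [c, e, d]" using dist by auto
  have e: "leans k d e (emb k c -` M)" if "\<not> s d c"
    using pushed_if_blocked[OF assms(1,2) dist assms(3) nonempty that[unfolded s_def]]
    by (simp add: leans_def)
  have d: "leans k e d (emb k c -` M)" if "\<not> s e c"
    using pushed_if_blocked[OF assms(1,2) dist' assms(3) nonempty that[unfolded s_def]]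
    by (simp add: leans_def)
  obtain x where x: "x \<in> emb k c -` M" using nonempty[of c] by blast
  then have "x \<noteq> ST_extreme k d" "x \<noteq> ST_extreme k e"
    using assms(2) dist by (auto simp: no_junction_def)
  then have "s d c \<or> s e c" using d e x unfolding leans_def by (meson less_asym)
  then consider "s d c" "s e c" | "\<not> s d c" "s e c" | "s d c" "\<not> s e c" by blast
  then show ?thesis
  proof cases
    case 1
    then show ?thesis using copy_bound[OF bounds(1) assms(1,2) dist] by (simp add: s_def)
  next
    case 2
    then show ?thesis using leaning_copy_bound[OF bounds(2) assms(1,2) dist e] by (simp add: s_def)
  next
    case 3
    then show ?thesis using leaning_copy_bound[OF bounds(2) assms(1,2) dist' d] by (simp add: s_def)
  qed
qed

text \<open>
  The bound on two copies is a separate hypothesis because it does not follow from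
  the other two when \<open>k = 2\<close>.
\<close>

lemma OV_bound_Suc:
  assumes "OV_bound k (b + 3)" "leaning_bound k (b + 2)" "k \<ge> 2" "b \<ge> 1"
    and two: "\<And>M c d e. OV (Suc k) M \<Longrightarrow> no_junction k M \<Longrightarrow> distinct [c, d, e] \<Longrightarrow>
      card (emb k c -` M) + card (emb k d -` M) \<le> 3 * b + 3"
  shows "OV_bound (Suc k) (3 * b + 3)"
  unfolding OV_bound_def
proof (intro allI impI)
  fix M assume M: "OV (Suc k) M"
  have d3: "distinct [Top, Left, Right]" "distinct [Left, Right, Top]" "distinct [Right, Top, Left]"
    "distinct [Left, Top, Right]" by simp_all
  show "card M \<le> 3 * b + 3"
  proof (cases "no_junction k M")
    case False
    then obtain c d where cd: "c \<noteq> d" "emb k c (ST_extreme k d) \<in> M" by (auto simp: no_junction_def)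
    then have "distinct [c, d, third c d]" using third_neq[OF cd(1)] by auto
    from card_junction[OF M this cd(2)] obtain e where "card M \<le> 3 \<or> card M \<le> 1 + card (emb k e -` M)"
      by blast
    moreover have "card (emb k e -` M) \<le> b + 3" using OV_emb[OF M] assms(1) by (simp add: OV_bound_def)
    ultimately show ?thesis using assms(4) by linarith
  next
    case nj: True
    note le = card_le_copies[OF M d3(1)]
    show ?thesis
    proof (cases "\<exists>f. emb k f -` M = {}")
      case True
      then obtain f where f: "emb k f -` M = {}" ..
      show ?thesis
        by (cases f; use le f two[OF M nj d3(1)] two[OF M nj d3(2)] two[OF M nj d3(3)] in simp)
    next
      case False
      then have ne: "emb k f -` M \<noteq> {}" for f by blast
      note bal = copy_balance[OF M nj assms(3) _ ne assms(1,2)]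
      \<comment> \<open>Each ordered pair of copies contributes a truth value and its negation,
        hence one. The three balances thus add up to
        \<open>card M + 6 \<le> 3 * b + 9\<close>.\<close>
      from bal[OF d3(1)] bal[OF d3(2)] bal[OF d3(3)] le show ?thesis
        unfolding of_bool_def by (simp split: if_splits)
    qed
  qed
qed

text \<open>Leaning empties copy \<open>t\<close> up to its outer corner and makes the part in the
  third copy \<open>l\<close> lean without corners, so that part has at most \<open>2 * b\<close>
  points. In the main case the copies \<open>t\<close> and \<open>r\<close> together hold at most
  \<open>b + 2\<close>.\<close>

lemma leaning_bound_Suc:
  assumes "OV_bound k (b + 3)" "k \<ge> 2" "b \<ge> 1"
    and strict: "\<And>N t r. t \<noteq> r \<Longrightarrow> OV k N \<Longrightarrow> leans k t r N \<Longrightarrow> ST_extreme k t \<notin> N \<Longrightarrow>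
      ST_extreme k r \<notin> N \<Longrightarrow> card N \<le> 2 * b"
  shows "leaning_bound (Suc k) (3 * b + 2)"
  unfolding leaning_bound_def
proof (intro allI impI)
  fix M t r assume tr: "t \<noteq> r" and M: "OV (Suc k) M" and lean: "leans (Suc k) t r M"
  define l where "l = third t r"
  have d: "distinct [t, l, r]" "distinct [l, r, t]" "distinct [t, r, l]" "distinct [r, l, t]"
    using third_neq[OF tr] tr by (auto simp: l_def)
  define Mt Ml Mr where def: "Mt = emb k t -` M" "Ml = emb k l -` M" "Mr = emb k r -` M"
  have V: "x \<in> V k" if "emb k c x \<in> M" for c x using OV_emb[OF M, of c] that by (auto simp: OV_def)
  have Mt: "Mt \<subseteq> {ST_extreme k t}"
  proof
    fix x assume x: "x \<in> Mt"
    then have xM: "emb k t x \<in> M" by (simp add: def)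
    from xM lean have "emb k t x = ST_extreme (Suc k) t \<or> del k x r + 2 ^ k < del k x t"
      using tr by (auto simp: leans_def del_Suc[OF V[OF xM]])
    then show "x \<in> {ST_extreme k t}"
      using dist_extreme_le[OF V[OF xM], of t] by (auto simp: emb_extreme[symmetric] emb_eq_iff)
  qed
  have Ml: "del k x r < del k x t" if "x \<in> Ml" for x
  proof -
    from that have xM: "emb k l x \<in> M" by (simp add: def)
    moreover have "emb k l x \<noteq> ST_extreme (Suc k) t"
      using d by (auto simp: emb_extreme[symmetric] emb_eq_iff)
    ultimately show ?thesis using lean d by (auto simp: leans_def del_Suc[OF V[OF xM]])
  qed
  have Mr: "del k x r < del k x t + 2 ^ k" if "x \<in> Mr" for x
  proof -
    from that have xM: "emb k r x \<in> M" by (simp add: def)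
    moreover have "emb k r x \<noteq> ST_extreme (Suc k) t"
      using d by (auto simp: emb_extreme[symmetric] emb_eq_iff)
    ultimately show ?thesis using lean d by (auto simp: leans_def del_Suc[OF V[OF xM]])
  qed
  have ntl: "ST_extreme k t \<notin> Ml" using Ml by fastforce
  have ntr: "ST_extreme k t \<notin> Mr" using Mr[of "ST_extreme k t"] tr by auto
  note le = card_le_copies[OF M d(1), folded def]
  have mt: "card Mt \<le> 1" using card_mono[OF _ Mt] by simp
  show "card M \<le> 3 * b + 2"
  proof (cases "emb k l (ST_extreme k r) \<in> M")
    case True
    with OV_junction[OF M d(2)] have "Ml \<subseteq> {ST_extreme k r, ST_extreme k t}" by (simp add: def)
    with ntl have l1: "Ml \<subseteq> {ST_extreme k r}" by blast
    from True have "emb k r (ST_extreme k l) \<in> M" by (simp add: emb_extreme_swap[of k l r])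
    with OV_junction[OF M d(4)] have "Mr \<subseteq> {ST_extreme k l, ST_extreme k t}" by (simp add: def)
    with ntr have "Mr \<subseteq> {ST_extreme k l}" by blast
    from card_mono[OF _ this] card_mono[OF _ l1] mt le show ?thesis using assms(3) by simp
  next
    case lr: False
    have jt: "emb k t (ST_extreme k c) \<notin> M" if "c \<noteq> t" for c
      using Mt that by (auto simp: def)
    have nj: "no_junction k M"
      unfolding no_junction_def
    proof (intro allI impI)
      fix c e :: corner assume "c \<noteq> e"
      with corner_cases3[OF d(1), of c] corner_cases3[OF d(1), of e]
      consider "c = t" "e \<noteq> t" | "e = t" "c \<noteq> t" | "c = l" "e = r" | "c = r" "e = l" by blast
      then show "emb k c (ST_extreme k e) \<notin> M"
      proof cases
        case 1
        then show ?thesis using jt by simp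
      next
        case 2
        then show ?thesis using jt[of c] by (simp add: emb_extreme_swap[of k c t])
      next
        case 3
        then show ?thesis using lr by simp
      next
        case 4
        then show ?thesis using lr by (simp add: emb_extreme_swap[of k r l])
      qed
    qed
    note cb = copy_bound[OF assms(1) M nj d(4), folded def]
    show ?thesis
    proof (cases "Ml = {}")
      case True
      with le mt cb assms(3) show ?thesis by simp
    next
      case False
      then obtain x where x: "x \<in> Ml" by blast
      then have xM: "emb k l x \<in> M" by (simp add: def)
      \<comment> \<open>A blocked \<open>y\<close> would send \<open>x\<close> on the detour through
        \<open>t\<close>. But \<open>x\<close> is strictly closer to \<open>r\<close> than to
        \<open>t\<close>, and corner \<open>l\<close> is at most \<open>2 ^ k\<close> farther from
        \<open>y\<close> than corner \<open>t\<close>.\<close>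
      have sl: "sees k Mr (ST_extreme k l)"
      proof (rule ccontr)
        assume "\<not> sees k Mr (ST_extreme k l)"
        then obtain y where y: "y \<in> V k" "\<not> gST k (Mr - {ST_extreme k l, y}) (ST_extreme k l) y"
          by (auto simp: sees_def)
        from detour_if_blocked[OF M nj d(2) xM y[unfolded def]] Ml[OF x] del_triangle[OF y(1), of l t]
        show False by linarith
      qed
      \<comment> \<open>From the outer corner of \<open>t\<close>, the detour through
        \<open>l\<close> can compete only for \<open>y\<close> equal to corner \<open>l\<close> of
        copy \<open>r\<close>, and \<open>sl\<close> shows that the two corners see each
        other.\<close>
      have "sees k Mr (ST_extreme k t)" if "Mt \<noteq> {}"
      proof (rule ccontr)
        assume "\<not> sees k Mr (ST_extreme k t)"
        then obtain y where y: "y \<in> V k" "\<not> gST k (Mr - {ST_extreme k t, y}) (ST_extreme k t) y"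
          by (auto simp: sees_def)
        from that Mt have "emb k t (ST_extreme k t) \<in> M" by (auto simp: def)
        from detour_if_blocked[OF M nj d(3) this y[unfolded def]] d
        have "del k y l + 2 ^ k \<le> del k y t" by simp
        with y(1) have "y = ST_extreme k l" by (rule extreme_if_del)
        with y(2) have "\<not> gST k (Mr - {ST_extreme k l, ST_extreme k t}) (ST_extreme k l) (ST_extreme k t)"
          by (simp add: geo_sym_ST[of k _ "ST_extreme k t"] insert_commute)
        with sl show False by (simp add: sees_def)
      qed
      \<comment> \<open>A point in \<open>Mt\<close> costs one, but makes corner \<open>t\<close> of
        copy \<open>r\<close> available in \<open>cb\<close>.\<close>
      then have "card Mt + card Mr \<le> b + 2"
        using cb sl mt by (cases "Mt = {}") auto
      moreover have "card Ml \<le> 2 * b"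
        using Ml ntl nj d unfolding def
        by (intro strict[OF tr OV_emb[OF M]]) (auto simp: leans_def no_junction_def)
      ultimately show ?thesis using le by linarith
    qed
  qed
qed

text \<open>For \<open>k = 0\<close> the side conditions of the two induction steps come from
  \<open>Z\<close> and \<open>two\<close>; later, \<open>3 ^ k \<ge> 3\<close> makes them
  consequences of the bounds themselves.\<close>

lemma bounds_if_base:
  assumes P: "OV_bound 2 4" and L: "leaning_bound 2 3"
    and Z: "\<And>N t r. t \<noteq> r \<Longrightarrow> OV 2 N \<Longrightarrow> leans 2 t r N \<Longrightarrow> ST_extreme 2 t \<notin> N \<Longrightarrow>
      ST_extreme 2 r \<notin> N \<Longrightarrow> card N \<le> 2"
    and two: "\<And>M c d e. OV 3 M \<Longrightarrow> no_junction 2 M \<Longrightarrow> distinct [c, d, e] \<Longrightarrow>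
      card (emb 2 c -` M) + card (emb 2 d -` M) \<le> 6"
  shows "OV_bound (k + 2) (3 ^ k + 3) \<and> leaning_bound (k + 2) (3 ^ k + 2)"
proof (induction k)
  case 0
  then show ?case using P L by (simp add: numeral_eq_Suc)
next
  case (Suc k)
  then have IH: "OV_bound (k + 2) (3 ^ k + 3)" "leaning_bound (k + 2) (3 ^ k + 2)" by auto
  have big: "k = 0 \<or> (3::nat) ^ k \<ge> 3" by (cases k) auto
  have "OV_bound (Suc (k + 2)) (3 * 3 ^ k + 3)"
  proof (rule OV_bound_Suc[OF IH])
    fix M and c d e :: corner assume M: "OV (Suc (k + 2)) M" "no_junction (k + 2) M" "distinct [c, d, e]"
    from big show "card (emb (k + 2) c -` M) + card (emb (k + 2) d -` M) \<le> 3 * 3 ^ k + 3"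
    proof
      assume "k = 0"
      then show ?thesis using two[of M c d e] M by (simp add: numeral_eq_Suc)
    next
      have "card (emb (k + 2) c -` M) \<le> 3 ^ k + 3" "card (emb (k + 2) d -` M) \<le> 3 ^ k + 3"
        using IH(1) OV_emb[OF M(1)] by (auto simp: OV_bound_def)
      moreover assume "(3::nat) ^ k \<ge> 3"
      ultimately show ?thesis by linarith
    qed
  qed auto
  moreover have "leaning_bound (Suc (k + 2)) (3 * 3 ^ k + 2)"
  proof (rule leaning_bound_Suc[OF IH(1)])
    fix N t r assume N: "t \<noteq> r" "OV (k + 2) N" "leans (k + 2) t r N" "ST_extreme (k + 2) t \<notin> N"
      "ST_extreme (k + 2) r \<notin> N"
    from big show "card N \<le> 2 * 3 ^ k"
    proof
      assume "k = 0"
      then show ?thesis using Z[of t r N] N by (simp add: numeral_eq_Suc)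
    next
      have "card N \<le> 3 ^ k + 2" using IH(2) N by (auto simp: leaning_bound_def)
      moreover assume "(3::nat) ^ k \<ge> 3"
      ultimately show ?thesis by linarith
    qed
  qed auto
  ultimately show ?case by simp
qed

text \<open>A copy with four points blocks its corner from a vertex other than corner
  \<open>e\<close>. The detour inequality is then strict, so the other copy leans and has at most
  two points; 4 + 2 and 3 + 3 both give six.\<close>

lemma two_copies_bound:
  assumes P: "OV_bound 2 4"
    and Z: "\<And>N t r. t \<noteq> r \<Longrightarrow> OV 2 N \<Longrightarrow> leans 2 t r N \<Longrightarrow> ST_extreme 2 t \<notin> N \<Longrightarrow>
      ST_extreme 2 r \<notin> N \<Longrightarrow> card N \<le> 2"
    and blocked: "\<And>N p q. p \<noteq> q \<Longrightarrow> OV 2 N \<Longrightarrow> card N > 3 \<Longrightarrow> ST_extreme 2 p \<notin> N \<Longrightarrow>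
      ST_extreme 2 q \<notin> N \<Longrightarrow>
      \<exists>y\<in>V 2. y \<noteq> ST_extreme 2 q \<and> \<not> gST 2 (N - {ST_extreme 2 p, y}) (ST_extreme 2 p) y"
    and M: "OV (Suc 2) M" "no_junction 2 M" "distinct [c, d, e]"
  shows "card (emb 2 c -` M) + card (emb 2 d -` M) \<le> 6"
proof -
  have two: "card (emb 2 d -` M) \<le> 2"
    if big: "card (emb 2 c -` M) > 3" and dist: "distinct [d, c, e]" for c d
  proof -
    have "d \<noteq> e" using dist by simp
    then obtain y where y: "y \<in> V 2" "y \<noteq> ST_extreme 2 e"
      "\<not> gST 2 (emb 2 c -` M - {ST_extreme 2 d, y}) (ST_extreme 2 d) y"
      using blocked[of d e "emb 2 c -` M"] OV_emb[OF M(1)] big M(2) dist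
      by (auto simp: no_junction_def)
    have "del 2 y d < del 2 y e + 2 ^ 2" using extreme_if_del[OF y(1), of e d] y(2) by linarith
    then have "del 2 x e < del 2 x c" if "emb 2 d x \<in> M" for x
      using detour_if_blocked[OF M(1,2) dist that y(1,3)] by linarith
    then show ?thesis
      using dist M(2) by (intro Z[of c e] OV_emb[OF M(1)]) (auto simp: leans_def no_junction_def)
  qed
  have "card (emb 2 f -` M) \<le> 4" for f using P OV_emb[OF M(1)] by (simp add: OV_bound_def)
  from this[of c] this[of d] two[of c d] two[of d c] M(3) show ?thesis by fastforce
qed

subsection \<open>The graph \<open>ST\<^sub>3\<^sup>2\<close>\<close>

text \<open>
  The 15 vertices of \<open>ST\<^sub>3\<^sup>2\<close> are, for distinct \<open>p\<close>, \<open>q\<close>, \<open>r\<close>: the extreme vertices \<open>P2 p p p\<close>, the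
  junctions \<open>P2 p q q = P2 q p p\<close>, the vertices \<open>P2 p p q\<close> between an extreme vertex and a
  junction, and the inner vertices \<open>P2 p q r = P2 p r q\<close>.
\<close>

definition P2 :: "corner \<Rightarrow> corner \<Rightarrow> corner \<Rightarrow> corner list" where
  "P2 a b c = emb (Suc 0) a (emb 0 b [c])"

lemma P2_in_verts [simp]: "P2 a b c \<in> V (Suc (Suc 0))"
  by (simp add: P2_def ST_0)

lemma third_simps: "third Top Left = Right" "third Left Top = Right" "third Top Right = Left"
  "third Right Top = Left" "third Left Right = Top" "third Right Left = Top"
  by (simp_all add: third_def)

lemma extreme_Suc: "ST_extreme (Suc k) c = emb k c (ST_extreme k c)"
  by (simp add: emb_extreme)

lemma P2_eq_iff: "P2 a b c = P2 d e f \<longleftrightarrow>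
   a = d \<and> (b = e \<and> c = f \<or> b \<noteq> e \<and> c = e \<and> f = b) \<or>
   a \<noteq> d \<and> b = d \<and> c = d \<and> e = a \<and> f = a"
  by (auto simp: P2_def emb_eq_iff extreme_Suc ST_extreme.simps(1))

text \<open>Reduces distances and geodesics in \<open>ST\<^sub>3 2\<close> to the triangle, where
  comparing corners decides them.\<close>

lemmas ST_eval = cross_if_regular[OF regular] cross_geo_def cross_dist_def Let_def ST_extreme.simps(1)
  extreme_Suc dist_ST_0 geo_ST_0 ST_0

text \<open>Each conflict is witnessed by the pair of vertices given to \<open>vis\<close>: every
  geodesic between them meets one of the other listed vertices. Permuting the corners gives further
  instances.\<close>

lemma blocked_P2:
  assumes "OV (Suc (Suc 0)) M" "distinct [p, q, r]"
  shows "\<not> (P2 r r r \<in> M \<and> P2 r r q \<in> M)"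
    "\<not> (P2 r r r \<in> M \<and> P2 q r r \<in> M)"
    "\<not> (P2 r r r \<in> M \<and> P2 q q r \<in> M)"
    "\<not> (P2 r r q \<in> M \<and> P2 q r r \<in> M)"
    "\<not> (P2 r r q \<in> M \<and> P2 q q r \<in> M)"
    "\<not> (P2 r r q \<in> M \<and> P2 q p r \<in> M)"
    "\<not> (P2 r r q \<in> M \<and> P2 q q p \<in> M)"
    "\<not> (P2 r r q \<in> M \<and> P2 p r r \<in> M)"
    "\<not> (P2 q r r \<in> M \<and> P2 r p q \<in> M)"
    "\<not> (P2 q r r \<in> M \<and> P2 p r r \<in> M)"
    "\<not> (P2 r r r \<in> M \<and> P2 q p r \<in> M \<and> P2 p q r \<in> M)"
    "\<not> (P2 r r q \<in> M \<and> P2 r r p \<in> M \<and> P2 r p q \<in> M)"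
    "\<not> (P2 r r q \<in> M \<and> P2 r r p \<in> M \<and> P2 p q q \<in> M)"
    "\<not> (P2 r p q \<in> M \<and> P2 q p r \<in> M \<and> P2 p q r \<in> M)"
proof -
  have ne: "p \<noteq> q" "p \<noteq> r" "q \<noteq> r" "q \<noteq> p" "r \<noteq> p" "r \<noteq> q" using assms(2) by auto
  have th: "third p q = r" "third q p = r" "third p r = q" "third r p = q" "third q r = p" "third r q = p"
    using assms(2) by (auto intro!: third_eq)
  have vis: "P2 a b c \<in> M \<Longrightarrow> gST (Suc (Suc 0)) (M - {P2 a b c, P2 d e f}) (P2 a b c) (P2 d e f)" for a b c d e f
    using assms(1) by (simp add: OV_def sees_def)
  show "\<not> (P2 r r r \<in> M \<and> P2 r r q \<in> M)"
    using vis[of r r r q q q] ne th by (auto simp: P2_def ST_eval emb_eq_iff)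
  show "\<not> (P2 r r r \<in> M \<and> P2 q r r \<in> M)"
    using vis[of r r r q q q] ne th by (auto simp: P2_def ST_eval emb_eq_iff)
  show "\<not> (P2 r r r \<in> M \<and> P2 q q r \<in> M)"
    using vis[of r r r q q q] ne th by (auto simp: P2_def ST_eval emb_eq_iff)
  show "\<not> (P2 r r q \<in> M \<and> P2 q r r \<in> M)"
    using vis[of r r q q q q] ne th by (auto simp: P2_def ST_eval emb_eq_iff)
  show "\<not> (P2 r r q \<in> M \<and> P2 q q r \<in> M)"
    using vis[of r r q q q q] ne th by (auto simp: P2_def ST_eval emb_eq_iff)
  show "\<not> (P2 r r q \<in> M \<and> P2 q p r \<in> M)"
    using vis[of q p r r r r] ne th by (auto simp: P2_def ST_eval emb_eq_iff)
  show "\<not> (P2 r r q \<in> M \<and> P2 q q p \<in> M)"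
    using vis[of q q p r r r] ne th by (auto simp: P2_def ST_eval emb_eq_iff)
  show "\<not> (P2 r r q \<in> M \<and> P2 p r r \<in> M)"
    using vis[of r r q p p p] ne th by (auto simp: P2_def ST_eval emb_eq_iff)
  show "\<not> (P2 q r r \<in> M \<and> P2 r p q \<in> M)"
    using vis[of r p q q q q] ne th by (auto simp: P2_def ST_eval emb_eq_iff)
  show "\<not> (P2 q r r \<in> M \<and> P2 p r r \<in> M)"
    using vis[of q r r p p r] ne th by (auto simp: P2_def ST_eval emb_eq_iff)
  show "\<not> (P2 r r r \<in> M \<and> P2 q p r \<in> M \<and> P2 p q r \<in> M)"
    using vis[of r r r p q q] ne th by (auto simp: P2_def ST_eval emb_eq_iff)
  show "\<not> (P2 r r q \<in> M \<and> P2 r r p \<in> M \<and> P2 r p q \<in> M)"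
    using vis[of r p q r r r] ne th by (auto simp: P2_def ST_eval emb_eq_iff)
  show "\<not> (P2 r r q \<in> M \<and> P2 r r p \<in> M \<and> P2 p q q \<in> M)"
    using vis[of p q q r r r] ne th by (auto simp: P2_def ST_eval emb_eq_iff)
  show "\<not> (P2 r p q \<in> M \<and> P2 q p r \<in> M \<and> P2 p q r \<in> M)"
    using vis[of r p q p q q] ne th by (auto simp: P2_def ST_eval emb_eq_iff)
qed

lemma verts_ST_2:
  assumes "distinct [p, q, r]"
  shows "V (Suc (Suc 0)) = set [P2 p p p, P2 q q q, P2 r r r, P2 p q q, P2 p r r, P2 q r r, P2 p q r, P2 q p r, P2 r p q, P2 p p q, P2 p p r, P2 q q p, P2 q q r, P2 r r p, P2 r r q]"
proof -
  have "v \<in> set [P2 p p p, P2 q q q, P2 r r r, P2 p q q, P2 p r r, P2 q r r, P2 p q r, P2 q p r, P2 r p q, P2 p p q, P2 p p r, P2 q q p, P2 q q r, P2 r r p, P2 r r q]" if "v \<in> V (Suc (Suc 0))" for v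
  proof -
    from that obtain a b c where v: "v = P2 a b c"
      by (auto simp: verts_ST_Suc ST_0 P2_def)
    have ne: "p \<noteq> q" "p \<noteq> r" "q \<noteq> r" "q \<noteq> p" "r \<noteq> p" "r \<noteq> q" using assms by auto
    show ?thesis
      using corner_cases3[OF assms, of a] corner_cases3[OF assms, of b] corner_cases3[OF assms, of c]
      by (elim disjE) (simp_all add: v P2_eq_iff ne)
  qed
  then show ?thesis by auto
qed

lemma del_P2:
  "del (Suc (Suc 0)) (P2 a a a) a = 0"
  "a \<noteq> b \<Longrightarrow> del (Suc (Suc 0)) (P2 a a a) b = 4"
  "a \<noteq> b \<Longrightarrow> del (Suc (Suc 0)) (P2 a a b) a = 1"
  "a \<noteq> b \<Longrightarrow> del (Suc (Suc 0)) (P2 a a b) b = 3"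
  "a \<noteq> b \<Longrightarrow> a \<noteq> c \<Longrightarrow> b \<noteq> c \<Longrightarrow> del (Suc (Suc 0)) (P2 a a b) c = 4"
  "a \<noteq> b \<Longrightarrow> del (Suc (Suc 0)) (P2 a b b) a = 2"
  "a \<noteq> b \<Longrightarrow> del (Suc (Suc 0)) (P2 a b b) b = 2"
  "a \<noteq> b \<Longrightarrow> a \<noteq> c \<Longrightarrow> b \<noteq> c \<Longrightarrow> del (Suc (Suc 0)) (P2 a b b) c = 4"
  "a \<noteq> b \<Longrightarrow> a \<noteq> c \<Longrightarrow> b \<noteq> c \<Longrightarrow> del (Suc (Suc 0)) (P2 a b c) a = 2"
  "a \<noteq> b \<Longrightarrow> a \<noteq> c \<Longrightarrow> b \<noteq> c \<Longrightarrow> del (Suc (Suc 0)) (P2 a b c) b = 3"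
  "a \<noteq> b \<Longrightarrow> a \<noteq> c \<Longrightarrow> b \<noteq> c \<Longrightarrow> del (Suc (Suc 0)) (P2 a b c) c = 3"
  by (auto simp: P2_def del_Suc ST_0 ST_extreme.simps(1) dist_ST_0)

text \<open>Turns a cardinality bound into arithmetic on truth values, to which conflicts apply as
  propositional constraints. Repetitions in \<open>L\<close> only weaken the bound.\<close>

lemma card_le_filter: "M \<subseteq> set L \<Longrightarrow> card M \<le> (\<Sum>v\<leftarrow>L. of_bool (v \<in> M))"
proof -
  assume "M \<subseteq> set L"
  then have "M = set (filter (\<lambda>v. v \<in> M) L)" by auto
  then have "card M = card (set (filter (\<lambda>v. v \<in> M) L))" by (rule arg_cong)
  also have "\<dots> \<le> length (filter (\<lambda>v. v \<in> M) L)" by (rule card_length)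
  also have "\<dots> = (\<Sum>v\<leftarrow>L. of_bool (v \<in> M))" by (induction L) auto
  finally show ?thesis .
qed

text \<open>Fixes one name per vertex, so that instances of \<open>blocked_P2\<close> for different
  permutations speak of the same terms.\<close>

lemma P2_swaps:
  assumes "distinct [p, q, r]"
  shows "P2 q p p = P2 p q q" "P2 r p p = P2 p r r" "P2 r q q = P2 q r r"
    "P2 p r q = P2 p q r" "P2 q r p = P2 q p r" "P2 r q p = P2 r p q"
  using assms by (auto simp: P2_eq_iff)

text \<open>The junction excludes ten vertices. Of the four others, \<open>P2 p p p\<close>,
  \<open>P2 p p q\<close> and \<open>P2 p p r\<close> exclude one another in its presence.\<close>

lemma card_if_junction_ST_2:
  assumes M: "OV (Suc (Suc 0)) M" and dist: "distinct [p, q, r]"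
    and x: "P2 q r r \<in> M"
  shows "card M \<le> 3"
proof -
  have d: "distinct [p, q, r]"
    "distinct [p, r, q]"
    "distinct [q, p, r]"
    "distinct [q, r, p]"
    "distinct [r, p, q]"
    "distinct [r, q, p]"
    using dist by auto
  note sw = P2_swaps[OF dist]
  have "P2 q q q \<notin> M \<and> P2 r r r \<notin> M \<and> P2 p q q \<notin> M \<and> P2 p r r \<notin> M \<and> P2 q p r \<notin> M \<and> P2 r p q \<notin> M \<and> P2 q q p \<notin> M \<and> P2 q q r \<notin> M \<and> P2 r r p \<notin> M \<and> P2 r r q \<notin> M"
    using x
      blocked_P2(2)[OF M d(1)] blocked_P2(2)[OF M d(2)] blocked_P2(4)[OF M d(1)]
      blocked_P2(4)[OF M d(2)] blocked_P2(8)[OF M d(3)] blocked_P2(8)[OF M d(5)]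
      blocked_P2(9)[OF M d(1)] blocked_P2(9)[OF M d(2)] blocked_P2(10)[OF M d(1)]
      blocked_P2(10)[OF M d(2)]
    unfolding sw by blast
  then have "M \<subseteq> set [P2 q r r, P2 p p p, P2 p q r, P2 p p q, P2 p p r]"
    using M unfolding OV_def verts_ST_2[OF dist] by auto
  from card_le_filter[OF this] show ?thesis
    using
      blocked_P2(1)[OF M d(4)] blocked_P2(1)[OF M d(6)] blocked_P2(12)[OF M d(4)]
      blocked_P2(13)[OF M d(4)]
    unfolding sw by (auto simp: of_bool_def split: if_splits)
qed

text \<open>\<open>P2 r r q\<close> excludes two junctions and \<open>n\<close> the third. Of the
  six candidates left, \<open>P2 r r p\<close> conflicts with four; without it,
  \<open>P2 p p q\<close> and \<open>P2 p p p\<close> still exclude each other.\<close>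

lemma card_if_side_ST_2:
  assumes M: "OV (Suc (Suc 0)) M" and dist: "distinct [p, q, r]"
    and x: "P2 r r q \<in> M"
    and n: "P2 p q q \<notin> M"
  shows "card M \<le> 4"
proof -
  have d: "distinct [p, q, r]"
    "distinct [p, r, q]"
    "distinct [q, p, r]"
    "distinct [q, r, p]"
    "distinct [r, p, q]"
    "distinct [r, q, p]"
    using dist by auto
  note sw = P2_swaps[OF dist]
  have "P2 q q q \<notin> M \<and> P2 r r r \<notin> M \<and> P2 p r r \<notin> M \<and> P2 q r r \<notin> M \<and> P2 q p r \<notin> M \<and> P2 p p r \<notin> M \<and> P2 q q p \<notin> M \<and> P2 q q r \<notin> M"
    using x
      blocked_P2(1)[OF M d(1)] blocked_P2(3)[OF M d(2)] blocked_P2(4)[OF M d(1)]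
      blocked_P2(5)[OF M d(1)] blocked_P2(6)[OF M d(1)] blocked_P2(7)[OF M d(1)]
      blocked_P2(7)[OF M d(4)] blocked_P2(8)[OF M d(1)]
    unfolding sw by blast
  with n have "M \<subseteq> set [P2 r r q, P2 r r p, P2 p p q, P2 p p p, P2 p q r, P2 r p q]"
    using M unfolding OV_def verts_ST_2[OF dist] by auto
  from card_le_filter[OF this] show ?thesis
    using
      blocked_P2(1)[OF M d(6)] blocked_P2(3)[OF M d(4)] blocked_P2(6)[OF M d(3)]
      blocked_P2(7)[OF M d(3)] blocked_P2(12)[OF M d(1)]
    unfolding sw by (auto simp: of_bool_def split: if_splits)
qed

text \<open>Two inner vertices exclude the extreme vertex of the third copy, and all three cannot
  occur together.\<close>

lemma card_if_inner_ST_2: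
  assumes M: "OV (Suc (Suc 0)) M" and dist: "distinct [p, q, r]"
    and n: "P2 p q q \<notin> M" "P2 p r r \<notin> M" "P2 q r r \<notin> M" "P2 p p q \<notin> M" "P2 p p r \<notin> M" "P2 q q p \<notin> M" "P2 q q r \<notin> M" "P2 r r p \<notin> M" "P2 r r q \<notin> M"
  shows "card M \<le> 4"
proof -
  have d: "distinct [p, q, r]"
    "distinct [p, r, q]"
    "distinct [q, p, r]"
    "distinct [q, r, p]"
    "distinct [r, p, q]"
    "distinct [r, q, p]"
    using dist by auto
  note sw = P2_swaps[OF dist]
  from n have "M \<subseteq> set [P2 p p p, P2 q q q, P2 r r r, P2 p q r, P2 q p r, P2 r p q]"
    using M unfolding OV_def verts_ST_2[OF dist] by auto
  from card_le_filter[OF this] show ?thesis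
    using
      blocked_P2(11)[OF M d(1)] blocked_P2(11)[OF M d(2)] blocked_P2(11)[OF M d(4)]
      blocked_P2(14)[OF M d(1)]
    unfolding sw by (auto simp: of_bool_def split: if_splits)
qed

text \<open>The candidates are those that \<open>leaning_subset_2\<close> leaves for a set leaning
  from \<open>p\<close> to \<open>q\<close>.\<close>

lemma card_if_leaning_ST_2:
  assumes M: "OV (Suc (Suc 0)) M" and dist: "distinct [p, q, r]"
    and sub: "M \<subseteq> set [P2 p p p, P2 q q q, P2 q q p, P2 q q r, P2 r r q, P2 q p r, P2 q r r]"
  shows "card M \<le> 3"
proof -
  have d: "distinct [p, q, r]"
    "distinct [p, r, q]"
    "distinct [q, p, r]"
    "distinct [q, r, p]"
    "distinct [r, p, q]"
    "distinct [r, q, p]"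
    using dist by auto
  note sw = P2_swaps[OF dist]
  from card_le_filter[OF sub] show ?thesis
    using
      blocked_P2(1)[OF M d(2)] blocked_P2(1)[OF M d(5)] blocked_P2(2)[OF M d(2)]
      blocked_P2(3)[OF M d(2)] blocked_P2(3)[OF M d(6)] blocked_P2(4)[OF M d(1)]
      blocked_P2(4)[OF M d(2)] blocked_P2(5)[OF M d(1)] blocked_P2(6)[OF M d(1)]
      blocked_P2(7)[OF M d(1)] blocked_P2(8)[OF M d(5)] blocked_P2(9)[OF M d(2)]
      blocked_P2(12)[OF M d(2)]
    unfolding sw by (auto simp: of_bool_def split: if_splits)
qed

lemma card_if_leaning_inner_ST_2:
  assumes M: "OV (Suc (Suc 0)) M" and dist: "distinct [p, q, r]"
    and sub: "M \<subseteq> set [P2 q q p, P2 q q r, P2 r r q, P2 q p r, P2 q r r]"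
  shows "card M \<le> 2"
proof -
  have d: "distinct [p, q, r]"
    "distinct [p, r, q]"
    "distinct [q, p, r]"
    "distinct [q, r, p]"
    "distinct [r, p, q]"
    "distinct [r, q, p]"
    using dist by auto
  note sw = P2_swaps[OF dist]
  from card_le_filter[OF sub] show ?thesis
    using
      blocked_P2(4)[OF M d(1)] blocked_P2(4)[OF M d(2)] blocked_P2(5)[OF M d(1)]
      blocked_P2(6)[OF M d(1)] blocked_P2(7)[OF M d(1)] blocked_P2(8)[OF M d(5)]
      blocked_P2(9)[OF M d(2)] blocked_P2(12)[OF M d(2)]
    unfolding sw by (auto simp: of_bool_def split: if_splits)
qed

text \<open>Each of the first five vertices lies on the only geodesic from \<open>P2 p p p\<close>
  to some target; the last two block both geodesics to \<open>P2 q r r\<close>. No target is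
  \<open>P2 q q q\<close>, because \<open>two_copies_bound\<close> asks for a blocked vertex other
  than this corner.\<close>

lemma blocked_from_extreme:
  assumes dist: "distinct [p, q, r]"
    and vis: "\<And>y. y \<in> V (Suc (Suc 0)) \<Longrightarrow> y \<noteq> P2 q q q \<Longrightarrow> gST (Suc (Suc 0)) (N - {P2 p p p, y}) (P2 p p p) y"
  shows "P2 p p q \<notin> N" "P2 p p r \<notin> N" "P2 p q q \<notin> N" "P2 p r r \<notin> N" "P2 r r p \<notin> N"
    "\<not> (P2 q p r \<in> N \<and> P2 r p q \<in> N)"
proof -
  have ne: "p \<noteq> q" "p \<noteq> r" "q \<noteq> r" "q \<noteq> p" "r \<noteq> p" "r \<noteq> q" using dist by auto
  have th: "third p q = r" "third q p = r" "third p r = q" "third r p = q" "third q r = p" "third r q = p"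
    using dist by (auto intro!: third_eq)
  have v: "gST (Suc (Suc 0)) (N - {P2 p p p, P2 a b c}) (P2 p p p) (P2 a b c)"
    if "P2 a b c \<noteq> P2 q q q" for a b c using vis[OF _ that] by simp
  show "P2 p p q \<notin> N" using v[of p q q] ne th by (auto simp: P2_def ST_eval emb_eq_iff)
  show "P2 p p r \<notin> N" using v[of p r r] ne th by (auto simp: P2_def ST_eval emb_eq_iff)
  show "P2 p q q \<notin> N" using v[of q q p] ne th by (auto simp: P2_def ST_eval emb_eq_iff)
  show "P2 p r r \<notin> N" using v[of r r p] ne th by (auto simp: P2_def ST_eval emb_eq_iff)
  show "P2 r r p \<notin> N" using v[of r r r] ne th by (auto simp: P2_def ST_eval emb_eq_iff)
  show "\<not> (P2 q p r \<in> N \<and> P2 r p q \<in> N)" using v[of q r r] ne th by (auto simp: P2_def ST_eval emb_eq_iff)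
qed

lemma blocked_if_card_4:
  assumes M: "OV (Suc (Suc 0)) M" and dist: "distinct [p, q, r]"
    and "card M > 3" "P2 p p p \<notin> M" "P2 q q q \<notin> M"
  shows "\<exists>y\<in>V (Suc (Suc 0)). y \<noteq> P2 q q q \<and> \<not> gST (Suc (Suc 0)) (M - {P2 p p p, y}) (P2 p p p) y"
proof (rule ccontr)
  assume "\<not> ?thesis"
  then have "gST (Suc (Suc 0)) (M - {P2 p p p, y}) (P2 p p p) y"
    if "y \<in> V (Suc (Suc 0))" "y \<noteq> P2 q q q" for y using that by blast
  note n = blocked_from_extreme[OF dist this]
  have d: "distinct [p, q, r]"
    "distinct [p, r, q]"
    "distinct [q, p, r]"
    "distinct [q, r, p]"
    "distinct [r, p, q]"
    "distinct [r, q, p]"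
    using dist by auto
  note sw = P2_swaps[OF dist]
  from n(1-5) assms(4,5) have sub: "M \<subseteq> set [P2 r r r, P2 q q p, P2 q q r, P2 r r q, P2 p q r, P2 q p r, P2 r p q, P2 q r r]"
    using M unfolding OV_def verts_ST_2[OF dist] by auto
  from card_le_filter[OF sub] have "card M \<le> 3"
    using n(6)
      blocked_P2(1)[OF M d(1)] blocked_P2(2)[OF M d(1)] blocked_P2(3)[OF M d(1)]
      blocked_P2(4)[OF M d(1)] blocked_P2(4)[OF M d(2)] blocked_P2(5)[OF M d(1)]
      blocked_P2(6)[OF M d(1)] blocked_P2(6)[OF M d(2)] blocked_P2(6)[OF M d(5)]
      blocked_P2(7)[OF M d(1)] blocked_P2(8)[OF M d(5)] blocked_P2(9)[OF M d(1)]
      blocked_P2(9)[OF M d(2)] blocked_P2(11)[OF M d(1)] blocked_P2(12)[OF M d(2)]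
      blocked_P2(14)[OF M d(1)]
    unfolding sw by (auto simp: of_bool_def split: if_splits)
  with assms(3) show False by simp
qed

lemma extreme_2: "ST_extreme (Suc (Suc 0)) c = P2 c c c"
  by (simp add: P2_def extreme_Suc ST_extreme.simps(1))

section \<open>The upper bound at all levels\<close>

lemma OV_bound_2: "OV_bound (Suc (Suc 0)) 4"
  unfolding OV_bound_def
proof (intro allI impI)
  fix M assume M: "OV (Suc (Suc 0)) M"
  have third: "distinct [third a b, a, b]" if "a \<noteq> b" for a b
    using third_neq[OF that] that by auto
  show "card M \<le> 4"
  proof (cases "\<forall>a b. a \<noteq> b \<longrightarrow> P2 a b b \<notin> M")
    case False
    then obtain a b where ab: "a \<noteq> b" "P2 a b b \<in> M" by auto
    from card_if_junction_ST_2[OF M third[OF ab(1)] ab(2)] show ?thesis by simp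
  next
    case J: True
    show ?thesis
    proof (cases "\<forall>a b. a \<noteq> b \<longrightarrow> P2 a a b \<notin> M")
      case False
      then obtain a b where ab: "a \<noteq> b" "P2 a a b \<in> M" by auto
      from third[OF ab(1)] have "distinct [third a b, b, a]" "third a b \<noteq> b" by auto
      from card_if_side_ST_2[OF M this(1) ab(2)] this(2) J show ?thesis by simp
    next
      case True
      with J show ?thesis by (intro card_if_inner_ST_2[OF M, of Top Left Right]) simp_all
    qed
  qed
qed

lemma leaning_subset_2:
  assumes "leans (Suc (Suc 0)) p q M" "M \<subseteq> V (Suc (Suc 0))" and dist: "distinct [p, q, r]"
  shows "M \<subseteq> set [P2 p p p, P2 q q q, P2 q q p, P2 q q r, P2 r r q, P2 q p r, P2 q r r]"
proof
  fix x assume x: "x \<in> M"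
  have ne: "p \<noteq> q" "p \<noteq> r" "q \<noteq> r" "q \<noteq> p" "r \<noteq> p" "r \<noteq> q" using dist by auto
  from x assms(1) have "x = P2 p p p \<or> del (Suc (Suc 0)) x q < del (Suc (Suc 0)) x p"
    by (auto simp: leans_def extreme_2)
  moreover from x assms(2) have "x \<in> V (Suc (Suc 0))" by blast
  ultimately show "x \<in> set [P2 p p p, P2 q q q, P2 q q p, P2 q q r, P2 r r q, P2 q p r, P2 q r r]"
    using ne unfolding verts_ST_2[OF dist] list.set insert_iff empty_iff
    by (elim disjE) (simp_all add: del_P2)
qed

lemma leaning_bound_2: "leaning_bound (Suc (Suc 0)) 3"
  unfolding leaning_bound_def
proof (intro allI impI)
  fix N t r assume *: "t \<noteq> r" "OV (Suc (Suc 0)) N" "leans (Suc (Suc 0)) t r N"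
  have dist: "distinct [t, r, third t r]" using third_neq[OF *(1)] *(1) by auto
  with leaning_subset_2[OF *(3) _ dist] *(2) show "card N \<le> 3"
    by (intro card_if_leaning_ST_2[OF *(2) dist]) (simp add: OV_def)
qed

lemma leaning_inner_bound_2:
  assumes "t \<noteq> r" "OV (Suc (Suc 0)) N" "leans (Suc (Suc 0)) t r N"
    "ST_extreme (Suc (Suc 0)) t \<notin> N" "ST_extreme (Suc (Suc 0)) r \<notin> N"
  shows "card N \<le> 2"
proof -
  have dist: "distinct [t, r, third t r]" using third_neq[OF assms(1)] assms(1) by auto
  with leaning_subset_2[OF assms(3) _ dist] assms(2,4,5) show "card N \<le> 2"
    by (intro card_if_leaning_inner_ST_2[OF assms(2) dist]) (auto simp: OV_def extreme_2)
qed

lemma OV_bound_ST: "OV_bound (Suc (Suc k)) (3 ^ k + 3)"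
proof -
  have "card (emb 2 c -` M) + card (emb 2 d -` M) \<le> 6"
    if "OV 3 M" "no_junction 2 M" "distinct [c, d, e]" for M c d e
  proof (rule two_copies_bound[OF _ _ _ _ that(2,3)])
    show "OV_bound 2 4" using OV_bound_2 by (simp add: numeral_2_eq_2)
    show "OV (Suc 2) M" using that(1) by simp
    show "card N \<le> 2" if "t \<noteq> r" "OV 2 N" "leans 2 t r N" "ST_extreme 2 t \<notin> N" "ST_extreme 2 r \<notin> N" for N t r
      using leaning_inner_bound_2[of t r N] that by (simp add: numeral_2_eq_2)
    fix N p q assume "p \<noteq> q" "OV 2 N" "card N > 3" "ST_extreme 2 p \<notin> N" "ST_extreme 2 q \<notin> N"
    then show "\<exists>y\<in>V 2. y \<noteq> ST_extreme 2 q \<and> \<not> gST 2 (N - {ST_extreme 2 p, y}) (ST_extreme 2 p) y"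
      using blocked_if_card_4[of N p q "third p q"] third_neq[of p q]
      unfolding numeral_2_eq_2 extreme_2 by auto
  qed
  with bounds_if_base[of k] OV_bound_2 leaning_bound_2 leaning_inner_bound_2
  have "OV_bound (k + 2) (3 ^ k + 3)" unfolding numeral_2_eq_2 by blast
  then show ?thesis by simp
qed

text \<open>Without junctions only the three extreme vertices remain; with one, the remaining copy
  adds at most two points if \<open>card_junction\<close> does not already give three.\<close>

lemma OV_bound_1: "OV_bound (Suc 0) 3"
  unfolding OV_bound_def
proof (intro allI impI)
  fix M assume M: "OV (Suc 0) M"
  show "card M \<le> 3"
  proof (cases "no_junction 0 M")
    case True
    have "emb 0 c -` M \<subseteq> {ST_extreme 0 c}" for c
    proof
      fix x assume x: "x \<in> emb 0 c -` M"
      with OV_emb[OF M, of c] obtain d where d: "x = ST_extreme 0 d"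
        by (auto simp: OV_def ST_0 ST_extreme.simps(1))
      then have "d = c" using x True[unfolded no_junction_def, rule_format, of c d] by auto
      with d show "x \<in> {ST_extreme 0 c}" by simp
    qed
    from card_mono[OF _ this] have "card (emb 0 c -` M) \<le> 1" for c by simp
    from this[of Top] this[of Left] this[of Right] card_le_copies[OF M, of Top Left Right]
    show ?thesis by simp
  next
    case False
    then obtain c d where cd: "c \<noteq> d" "emb 0 c (ST_extreme 0 d) \<in> M" by (auto simp: no_junction_def)
    define e where "e = third c d"
    have dist: "distinct [c, d, e]" "distinct [e, c, d]" using third_neq[OF cd(1)] cd(1) by (auto simp: e_def)
    have "card (emb 0 e -` M) \<le> 2"
    proof (cases "ST_extreme 0 c \<in> emb 0 e -` M")
      case True
      with OV_junction[OF M dist(2)] have "emb 0 e -` M \<subseteq> {ST_extreme 0 c, ST_extreme 0 d}" by simp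
      from card_mono[OF _ this] dist show ?thesis by simp
    next
      case False
      have "emb 0 e -` M \<subseteq> {ST_extreme 0 d, ST_extreme 0 e}"
      proof
        fix x assume x: "x \<in> emb 0 e -` M"
        with OV_emb[OF M, of e] obtain f where "x = ST_extreme 0 f"
          by (auto simp: OV_def ST_0 ST_extreme.simps(1))
        with x False corner_cases3[OF dist(1), of f] show "x \<in> {ST_extreme 0 d, ST_extreme 0 e}" by auto
      qed
      from card_mono[OF _ this] dist show ?thesis by simp
    qed
    with card_junction[OF M dist(1) cd(2)] show ?thesis by linarith
  qed
qed

subsection \<open>The lower bound\<close>

text \<open>The extreme vertices are left out so that the copies of \<open>C\<close> stay disjoint under glueing.\<close>

definition transparent :: "nat \<Rightarrow> corner list set \<Rightarrow> bool" where
  "transparent k C \<longleftrightarrow> C \<subseteq> V k \<and> (\<forall>c. ST_extreme k c \<notin> C) \<and> (\<forall>u \<in> C \<union> range (ST_extreme k). sees k C u)"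

lemma vimage_emb_Union:
  assumes "\<forall>c. ST_extreme k c \<notin> C"
  shows "emb k c -` (\<Union>d. emb k d ` C) = C"
  using assms by (auto simp: emb_eq_iff)

text \<open>Since \<open>x\<close> and all corners see their whole copies, every leg of both the
  direct route and the detour can be chosen free. Whichever route is shorter is therefore
  usable.\<close>

lemma transparent_Suc:
  assumes "transparent k C"
  shows "transparent (Suc k) (\<Union>c. emb k c ` C)"
proof -
  let ?C = "\<Union>c. emb k c ` C"
  have C: "C \<subseteq> V k" "\<forall>c. ST_extreme k c \<notin> C" "\<And>c. sees k C (ST_extreme k c)" "\<And>u. u \<in> C \<Longrightarrow> sees k C u"
    using assms by (auto simp: transparent_def)
  note vim = vimage_emb_Union[OF C(2)]
  have sees: "sees (Suc k) ?C (emb k c x)" if x: "x \<in> V k" "sees k C x" for c x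
    unfolding sees_def
  proof
    fix v assume "v \<in> V (Suc k)"
    then obtain d y where v: "v = emb k d y" "y \<in> V k" by (auto simp: verts_ST_Suc)
    let ?X = "?C - {emb k c x, v}"
    show "gST (Suc k) ?X (emb k c x) v"
    proof (cases "d = c")
      case True
      then show ?thesis using x v vimage_emb_Diff[of k c ?C x y]
        by (simp add: geo_same vim sees_def)
    next
      case False
      define e where "e = third c d"
      have e: "distinct [c, d, e]" using third_neq[of c d] False by (auto simp: e_def)
      have ext: "gST k C (ST_extreme k a) (ST_extreme k b)" for a b
        using C(2) C(3)[of a, unfolded sees_def, rule_format, OF extreme_in_verts, of b] by simp
      define Y where "Y f = emb k f -` ?X" for f
      have "Y f \<subseteq> emb k f -` ?C" for f unfolding Y_def by (rule vimage_mono) simp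
      then have Y: "Y f \<subseteq> C" for f unfolding vim .
      have "x \<notin> Y c" "y \<notin> Y d" by (simp_all add: Y_def v(1))
      moreover have "ST_extreme k f \<notin> Y g" for f g using Y[of g] C(2) by blast
      \<comment> \<open>No corner lies in \<open>Y\<close>, and neither endpoint lies in its own
        copy's part, so the sets avoided in \<open>sees\<close> are large enough.\<close>
      ultimately have sub: "Y c \<subseteq> C - {x, ST_extreme k f}" "Y d \<subseteq> C - {ST_extreme k f, y}" for f
        by (simp_all add: subset_Diff_insert Y)
      have gc: "gST k (Y c) x (ST_extreme k f)" for f
        by (rule geo_antimono[OF x(2)[unfolded sees_def, rule_format, OF extreme_in_verts] sub(1)])
      have gd: "gST k (Y d) (ST_extreme k f) y" for f
        by (rule geo_antimono[OF C(3)[unfolded sees_def, rule_format, OF v(2)] sub(2)])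
      have "gST k (Y e) (ST_extreme k c) (ST_extreme k d)" by (rule geo_antimono[OF ext Y])
      then show ?thesis
        using gc[of d] gc[of e] gd[of c] gd[of e]
        unfolding v(1) geo_cross[OF e x(1) v(2)] Y_def
        by (simp add: nat_le_linear)
    qed
  qed
  show ?thesis
    unfolding transparent_def
  proof (intro conjI allI ballI)
    show "?C \<subseteq> V (Suc k)" using C(1) by auto
    show "ST_extreme (Suc k) c \<notin> ?C" for c
      using C(2) by (auto simp: emb_extreme[symmetric] emb_eq_iff)
    fix u assume "u \<in> ?C \<union> range (ST_extreme (Suc k))"
    then consider c x where "u = emb k c x" "x \<in> C" | c where "u = ST_extreme (Suc k) c" by auto
    then show "sees (Suc k) ?C u"
    proof cases
      case 1
      then show ?thesis using sees[OF subsetD[OF C(1)] C(4)] by simp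
    next
      case 2
      then show ?thesis using sees[OF extreme_in_verts C(3)] by (simp add: emb_extreme[symmetric])
    qed
  qed
qed

lemma card_Union_emb:
  assumes "transparent k C"
  shows "card (\<Union>c. emb k c ` C) = 3 * card C"
proof -
  have C: "\<forall>c. ST_extreme k c \<notin> C" "finite C"
    using assms finite_verts_ST finite_subset by (auto simp: transparent_def)
  have "card (emb k c ` C) = card C" for c by (rule card_image) (auto simp: inj_on_def emb_eq_iff)
  moreover have "emb k c ` C \<inter> emb k d ` C = {}" if "c \<noteq> d" for c d
    using that C(1) by (auto simp: emb_eq_iff)
  ultimately have "card (\<Union>c. emb k c ` C) = (\<Sum>c\<in>(UNIV :: corner set). card C)"
    using C(2) by (subst card_UN_disjoint) auto
  also have "\<dots> = 3 * card C" by (simp add: card_UNIV_corner)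
  finally show ?thesis .
qed

text \<open>A geodesic that starts at an extreme vertex and passes through the inner vertex can be
  exchanged for one around it; evaluation over all corners confirms this.\<close>

lemma transparent_2: "transparent (Suc (Suc 0)) {P2 Top Left Right}"
proof -
  have "gST (Suc (Suc 0)) ({P2 Top Left Right} - {P2 e e e, P2 a b c}) (P2 e e e) (P2 a b c)" for a b c e
    by (cases e; cases a; cases b; cases c; simp add: P2_def ST_eval emb_eq_iff third_simps)
  moreover have "\<exists>a b c. v = P2 a b c" if "v \<in> V (Suc (Suc 0))" for v
    using that by (auto simp: verts_ST_Suc ST_0 P2_def)
  ultimately have "sees (Suc (Suc 0)) {P2 Top Left Right} (P2 e e e)" for e
    unfolding sees_def by metis
  moreover have "sees (Suc (Suc 0)) {P2 Top Left Right} (P2 Top Left Right)"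
    by (simp add: sees_def geo_empty_ST)
  ultimately show ?thesis
    by (auto simp: transparent_def extreme_2 P2_eq_iff)
qed

lemma ex_transparent: "\<exists>C. transparent (Suc (Suc k)) C \<and> card C = 3 ^ k"
proof (induction k)
  case 0
  then show ?case using transparent_2 by (intro exI[of _ "{P2 Top Left Right}"]) auto
next
  case (Suc k)
  then show ?case using transparent_Suc card_Union_emb by (metis power_Suc)
qed

lemma OV_add_extremes:
  assumes "transparent k C"
  shows "OV k (C \<union> range (ST_extreme k))" "card (C \<union> range (ST_extreme k)) = card C + 3"
proof -
  have C: "OV k C" "\<And>c. sees k C (ST_extreme k c)" "\<And>c. ST_extreme k c \<notin> C"
    using assms by (auto simp: transparent_def OV_def)
  show "OV k (C \<union> range (ST_extreme k))" by (rule OV_Un_extremes[OF C(1,2)])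
  show "card (C \<union> range (ST_extreme k)) = card C + 3"
    using card_Un_extremes[OF C(1), of UNIV] C(3) by (simp add: card_UNIV_corner)
qed

lemma outer_mutual_visibility_number_eqI:
  assumes "OV_bound k b" "transparent k C" "card C + 3 = b"
  shows "\<mu>\<^sub>o (ST\<^sub>3 k) = b"
  unfolding outer_mutual_visibility_number_def OV_iff
proof (rule Max_eqI)
  have "{M. OV k M} \<subseteq> Pow (V k)" by (auto simp: OV_def)
  then show "finite (card ` {M. OV k M})" using finite_verts_ST finite_subset by blast
  show "b \<in> card ` {M. OV k M}" using OV_add_extremes[OF assms(2)] assms(3) by (metis imageI mem_Collect_eq)
  show "y \<le> b" if "y \<in> card ` {M. OV k M}" for y using that assms(1) by (auto simp: OV_bound_def)
qed

theorem theorem3: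
  fixes n :: nat
  assumes "n \<ge> 1"
  shows "\<mu>\<^sub>o (ST\<^sub>3 n) = (if n = 1 then 3 else 3 ^ (n - 2) + 3)"
proof (cases "n = 1")
  case True
  \<comment> \<open>For \<open>n = 1\<close> the extreme vertices alone attain the bound.\<close>
  have "transparent (Suc 0) {}" by (auto simp: transparent_def sees_def geo_empty_ST)
  from outer_mutual_visibility_number_eqI[OF OV_bound_1 this] True show ?thesis by simp
next
  case False
  with assms obtain k where n: "n = Suc (Suc k)" by (metis One_nat_def Suc_le_D not0_implies_Suc)
  from ex_transparent[of k] obtain C where "transparent n C" "card C = 3 ^ k" unfolding n by blast
  from outer_mutual_visibility_number_eqI[OF OV_bound_ST[of k] this(1)[unfolded n]] this(2) show ?thesis using n by simp
qed

end
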